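(* Let $G$ be a nearly split extension of groups $N\triangleleft G$ and $H$; that is, $H$ is a subgroup of $G$ such that $NH$ has finite index in $G$ and $N\cap H$ is finite. Suppose that $N$ and $H$ have asynchronous $\mathcal{F}$-combings $L_N$ and $L_H$ over generating sets $X$ and $Y$ respectively, for some language family $\mathcal{F}$ which is closed under concatenation. If $H\cap N$ is non-trivial, suppose further that $L_N$ is an asynchronous bicombing. Suppose also that there is a constant $K$ such that for all $n\in N$, all $y\in Y$, and all words $v_n$ and $v_{n^y}$ in $L_N$ representing $n$ and $n^y$ respectively, $v_{n^y}$ asynchronously $K$-fellow travels (over $X$) with each of the images of $v_n$ under $y$. Then $G$ has an asynchronous combing $L_G$. If $L_H$ and $L_N$ are bijective and the extension is split (that is, $G=NH$ and $N\cap H=1$), then $L_G$ is also bijective.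
   Context: Generating sets are finite and inverse closed. For a group $G$ with identity $e$ and generating set $X$, $X^*$ is the set of all words over $X$; $w=_G v$ means that $w,v$ represent the same element of $G$; $l(w)$ is the length of $w$ as a string. $\Gamma_{G,X}$ is the Cayley graph (an edge labelled $x$ from $g$ to $gx$), and $d_{G,X}$ is the graph distance on vertices, extended to the path metric on the 1-skeleton. A word $w$ is identified with the path from $e$ labelled by $w$: for $0\le t<l(w)$, $w(t)$ is the point at distance $t$ along the path, and $w(t)=w(l(w))$ for $t\ge l(w)$. Words $v,w$ asynchronously $K$-fellow travel if there is a strictly increasing differentiable $h:\mathbf{R}\to\mathbf{R}$ mapping $[0,l(v)]$ onto $[0,l(w)]$ with $d_{G,X}(v(t),w(h(t)))\le K$ for all $t>0$. A language for $G$ over $X$ is a subset $L\subseteq X^*$ containing at least one representative of each element of $G$; it is bijective if it contains exactly one of each. $L$ is an asynchronous combing if there is a constant $K$ such that all pairs $v,w\in L$ with $w=_G vx$ for some $x\in X\cup\{e\}$ asynchronously $K$-fellow travel. It is an asynchronous bicombing if moreover, for all $v,w\in L$ and $x\in X$ with $w=_G xv$, the words $xv$ and $w$ asynchronously $K$-fellow travel. A group has a combing of a given kind if it has one over some finite generating set. A family of languages $\mathcal{F}$ is any non-empty set of languages over finite alphabets; an $\mathcal{F}$-combing is a combing which is a language in $\mathcal{F}$. Closure under concatenation: $L,L'\in\mathcal{F}$ implies $LL'\in\mathcal{F}$. $H$ acts on $N$ by automorphisms $n\mapsto n^h=h^{-1}nh$. For a word $v_n=x_1x_2\ldots x_m\in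 L_N$ representing $n\in N$ and $h\in H$, a word $w$ is an image of $v_n$ under $h$ if $w=v_{x_1^h}v_{x_2^h}\ldots v_{x_m^h}$ where, for each $i$, $v_{x_i^h}$ is a word in $L_N$ representing $x_i^h$. *)

theory Defs
  imports Complex_Main "HOL-Algebra.Coset" "HOL-Algebra.Generated_Groups"
begin

text \<open>
  A group is a HOL-Algebra structure \<open>G\<close>, and an alphabet is a set of elements of \<open>G\<close>, so that a
  word is a list of group elements. A subgroup \<open>N\<close> is viewed as a group by restricting the carrier.
\<close>

definition generating_set :: "('a, 'b) monoid_scheme \<Rightarrow> 'a set \<Rightarrow> bool" where
  "generating_set G X \<longleftrightarrow> finite X \<and> X \<subseteq> carrier G \<and> (\<forall>x\<in>X. inv\<^bsub>G\<^esub> x \<in> X) \<and>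
     generate G X = carrier G"

definition word_val :: "('a, 'b) monoid_scheme \<Rightarrow> 'a list \<Rightarrow> 'a" where
  "word_val G w = foldr (\<lambda>x g. x \<otimes>\<^bsub>G\<^esub> g) w \<one>\<^bsub>G\<^esub>"

text \<open>
  Graph distance on the vertices of the Cayley graph: edge paths starting at \<open>g\<close> correspond to
  words \<open>w\<close> over \<open>X\<close>, the path labelled \<open>w\<close> ending at \<open>g w\<close>.
\<close>

definition cayley_dist :: "('a, 'b) monoid_scheme \<Rightarrow> 'a set \<Rightarrow> 'a \<Rightarrow> 'a \<Rightarrow> nat" where
  "cayley_dist G X g g' =
     (LEAST n. \<exists>w\<in>lists X. length w = n \<and> g \<otimes>\<^bsub>G\<^esub> word_val G w = g')"

text \<open>
  \<open>Edge_pt g x s\<close>, for \<open>0 \<le> s \<le> 1\<close>, is the point at distance \<open>s\<close> from \<open>g\<close> on the edge labelled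
  \<open>x\<close> from \<open>g\<close> to \<open>g x\<close>. For \<open>s = 0\<close> and \<open>s = 1\<close> it denotes the same point of the 1-skeleton as
  \<open>Vertex g\<close> and \<open>Vertex (g x)\<close>; the distance below does not distinguish them.
\<close>

datatype 'a skeleton_pt = Vertex 'a | Edge_pt 'a 'a real

text \<open>Adjacent vertices, each with its distance along the edge.\<close>

fun exits :: "('a, 'b) monoid_scheme \<Rightarrow> 'a skeleton_pt \<Rightarrow> ('a \<times> real) set" where
  "exits G (Vertex g) = {(g, 0)}"
| "exits G (Edge_pt g x s) = {(g, s), (g \<otimes>\<^bsub>G\<^esub> x, 1 - s)}"

fun within_edge :: "'a skeleton_pt \<Rightarrow> 'a skeleton_pt \<Rightarrow> real set" where
  "within_edge (Edge_pt g x s) (Edge_pt g' x' s') = (if g = g' \<and> x = x' then {\<bar>s - s'\<bar>} else {})"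
| "within_edge _ _ = {}"

text \<open>
  Path metric of the 1-skeleton, all edges having length 1: a shortest path between two points either
  stays inside one edge, or leaves the edge of the first point at a vertex, follows a geodesic edge
  path, and enters the edge of the second point at a vertex. There is one edge for each pair
  \<open>(g, x)\<close>; identifying the edge \<open>x\<close> at \<open>g\<close> with the edge \<open>inv x\<close> at \<open>g x\<close> would change distances
  by at most 1.
\<close>

definition skeleton_dist ::
  "('a, 'b) monoid_scheme \<Rightarrow> 'a set \<Rightarrow> 'a skeleton_pt \<Rightarrow> 'a skeleton_pt \<Rightarrow> real" where
  "skeleton_dist G X p q =
     Min (within_edge p q \<union>
       (\<lambda>((g, a), (g', b)). a + real (cayley_dist G X g g') + b) ` (exits G p \<times> exits G q))"

text \<open>The point \<open>w(t)\<close>; meaningful for \<open>t \<ge> 0\<close> only.\<close>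

definition path_pt :: "('a, 'b) monoid_scheme \<Rightarrow> 'a list \<Rightarrow> real \<Rightarrow> 'a skeleton_pt" where
  "path_pt G w t =
     (if t < real (length w)
      then Edge_pt (word_val G (take (nat \<lfloor>t\<rfloor>) w)) (w ! nat \<lfloor>t\<rfloor>) (frac t)
      else Vertex (word_val G w))"

text \<open>
  The conditions on \<open>h\<close> force \<open>h 0 = 0\<close>, so \<open>h t > 0\<close> for \<open>t > 0\<close>. They also force that the
  empty word fellow travels only with itself.
\<close>

definition async_fellow_travel ::
  "('a, 'b) monoid_scheme \<Rightarrow> 'a set \<Rightarrow> real \<Rightarrow> 'a list \<Rightarrow> 'a list \<Rightarrow> bool" where
  "async_fellow_travel G X K v w \<longleftrightarrow>
     (\<exists>h :: real \<Rightarrow> real. strict_mono h \<and> (\<forall>t. h differentiable (at t)) \<and>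
        h ` {0..real (length v)} = {0..real (length w)} \<and>
        (\<forall>t>0. skeleton_dist G X (path_pt G v t) (path_pt G w (h t)) \<le> K))"

definition language_for :: "('a, 'b) monoid_scheme \<Rightarrow> 'a set \<Rightarrow> 'a list set \<Rightarrow> bool" where
  "language_for G X L \<longleftrightarrow> L \<subseteq> lists X \<and> (\<forall>g\<in>carrier G. \<exists>w\<in>L. word_val G w = g)"

definition bijective_language :: "('a, 'b) monoid_scheme \<Rightarrow> 'a set \<Rightarrow> 'a list set \<Rightarrow> bool" where
  "bijective_language G X L \<longleftrightarrow> L \<subseteq> lists X \<and> (\<forall>g\<in>carrier G. \<exists>!w. w \<in> L \<and> word_val G w = g)"

definition right_fellow_travel ::
  "('a, 'b) monoid_scheme \<Rightarrow> 'a set \<Rightarrow> real \<Rightarrow> 'a list set \<Rightarrow> bool" where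
  "right_fellow_travel G X K L \<longleftrightarrow>
     (\<forall>v\<in>L. \<forall>w\<in>L. \<forall>x \<in> X \<union> {\<one>\<^bsub>G\<^esub>}.
        word_val G w = word_val G v \<otimes>\<^bsub>G\<^esub> x \<longrightarrow> async_fellow_travel G X K v w)"

definition left_fellow_travel ::
  "('a, 'b) monoid_scheme \<Rightarrow> 'a set \<Rightarrow> real \<Rightarrow> 'a list set \<Rightarrow> bool" where
  "left_fellow_travel G X K L \<longleftrightarrow>
     (\<forall>v\<in>L. \<forall>w\<in>L. \<forall>x\<in>X.
        word_val G w = x \<otimes>\<^bsub>G\<^esub> word_val G v \<longrightarrow> async_fellow_travel G X K (x # v) w)"

definition async_combing :: "('a, 'b) monoid_scheme \<Rightarrow> 'a set \<Rightarrow> 'a list set \<Rightarrow> bool" where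
  "async_combing G X L \<longleftrightarrow> generating_set G X \<and> language_for G X L \<and>
     (\<exists>K. right_fellow_travel G X K L)"

definition async_bicombing :: "('a, 'b) monoid_scheme \<Rightarrow> 'a set \<Rightarrow> 'a list set \<Rightarrow> bool" where
  "async_bicombing G X L \<longleftrightarrow> generating_set G X \<and> language_for G X L \<and>
     (\<exists>K. right_fellow_travel G X K L \<and> left_fellow_travel G X K L)"

definition language_family :: "'a list set set \<Rightarrow> bool" where
  "language_family F \<longleftrightarrow> F \<noteq> {} \<and> (\<forall>L\<in>F. \<exists>A. finite A \<and> L \<subseteq> lists A)"

definition closed_under_concatenation :: "'a list set set \<Rightarrow> bool" where
  "closed_under_concatenation F \<longleftrightarrow> (\<forall>L\<in>F. \<forall>L'\<in>F. {u @ v |u v. u \<in> L \<and> v \<in> L'} \<in> F)"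

definition async_F_combing ::
  "'a list set set \<Rightarrow> ('a, 'b) monoid_scheme \<Rightarrow> 'a set \<Rightarrow> 'a list set \<Rightarrow> bool" where
  "async_F_combing F G X L \<longleftrightarrow> async_combing G X L \<and> L \<in> F"

definition conj_by :: "('a, 'b) monoid_scheme \<Rightarrow> 'a \<Rightarrow> 'a \<Rightarrow> 'a" where
  "conj_by G n h = inv\<^bsub>G\<^esub> h \<otimes>\<^bsub>G\<^esub> n \<otimes>\<^bsub>G\<^esub> h"

definition is_image_under ::
  "('a, 'b) monoid_scheme \<Rightarrow> 'a list set \<Rightarrow> 'a list \<Rightarrow> 'a \<Rightarrow> 'a list \<Rightarrow> bool" where
  "is_image_under G L v h w \<longleftrightarrow>
     (\<exists>us. list_all2 (\<lambda>x u. u \<in> L \<and> word_val G u = conj_by G x h) v us \<and> w = concat us)"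

definition nearly_split_extension :: "('a, 'b) monoid_scheme \<Rightarrow> 'a set \<Rightarrow> 'a set \<Rightarrow> bool" where
  "nearly_split_extension G N H \<longleftrightarrow> group G \<and> N \<lhd> G \<and> subgroup H G \<and>
     finite (rcosets\<^bsub>G\<^esub> (N <#>\<^bsub>G\<^esub> H)) \<and> finite (N \<inter> H)"

definition split_extension :: "('a, 'b) monoid_scheme \<Rightarrow> 'a set \<Rightarrow> 'a set \<Rightarrow> bool" where
  "split_extension G N H \<longleftrightarrow> group G \<and> N \<lhd> G \<and> subgroup H G \<and>
     N <#>\<^bsub>G\<^esub> H = carrier G \<and> N \<inter> H = {\<one>\<^bsub>G\<^esub>}"

end

theory Submission
  imports Defs
begin

text \<open>
  Every element of \<open>G\<close> is a product \<open>h n t\<close> with \<open>h \<in> H\<close>, \<open>n \<in> N\<close> and \<open>t\<close> in a finite transversal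
  \<open>T\<close> of \<open>N H\<close>, and the combing of \<open>G\<close> consists of the words \<open>u v t\<close> with \<open>u \<in> L\<^sub>H\<close>, \<open>v \<in> L\<^sub>N\<close> and
  \<open>t \<in> T\<close>. Multiplying \<open>h n\<close> on the right by a letter of \<open>X\<close> changes only \<open>n\<close>, so the words for \<open>N\<close>
  fellow travel because \<open>L\<^sub>N\<close> is a combing. Multiplying by a letter \<open>y\<close> of \<open>Y\<close> gives \<open>(h y) n\<^sup>y\<close>: the
  words for \<open>h\<close> and \<open>h y\<close> fellow travel, and the words for \<open>n\<close> and \<open>n\<^sup>y\<close>, read from \<open>h\<close> and from
  \<open>h y\<close>, do so too, because an image of the first word under \<open>y\<close> stays at bounded distance from
  it and fellow travels with the second. If \<open>N \<inter> H\<close> is non-trivial, then an element of \<open>H N\<close> can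
  be written as a product in several ways, which differ by the finitely many elements of \<open>N \<inter> H\<close>;
  the bicombing hypothesis on \<open>L\<^sub>N\<close> absorbs this difference. Finally, changing \<open>t\<close> to \<open>t'\<close> while
  multiplying by a generator \<open>z\<close> amounts to multiplying \<open>h n\<close> by one of the finitely many elements
  \<open>t z t'\<^sup>-\<^sup>1\<close>, which is a word in the letters of \<open>X\<close> and \<open>Y\<close>. If the extension is split, then
  \<open>T\<close> has one element and \<open>h\<close> and \<open>n\<close> are determined by \<open>h n\<close>, so unique representatives in \<open>H\<close>
  and \<open>N\<close> give unique representatives in \<open>G\<close>.

  All these arguments concatenate and compose fellow travelling pairs, for which differentiable
  reparametrisations are inconvenient: their inverses need not be differentiable, and they are
  awkward to glue. The proof therefore works with a discrete notion. Two words are \<open>coupled\<close> if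
  they can be read letter by letter, one letter of one of the words at a time, in such a way that
  the element leading from the current vertex of one path to that of the other always lies in a
  fixed finite set \<open>B\<close>. Since \<open>B\<close> replaces both the constant and the generating set, being
  coupled is independent of the generating set, and it is symmetric, transitive and compatible
  with concatenation at the price of enlarging \<open>B\<close>.

  The translation between the two notions is the analytic part of the proof. A reparametrisation
  yields a coupling by recording the order in which the two paths reach their vertices
  (\<open>coupled_of_async_fellow_travel\<close>). Conversely a coupling determines a step function, which is
  smoothed to a strictly increasing differentiable function that stays within 1 of its steps
  (\<open>smooth_increasing_interpolation\<close>, \<open>async_fellow_travel_of_coupled\<close>). The empty word fellow
  travels with no other word, which is why a letter \<open>t\<close> is appended to every word of the combing
  of \<open>G\<close>, also when \<open>G = N H\<close>.
\<close>

section \<open>Smooth reparametrisations\<close>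

text \<open>
  A differentiable function that increases from 0 to 1 on the unit interval and is constant
  on either side of it. The squares make the one-sided parts differentiable at 0, and dividing
  by their sum avoids a definition by cases.
\<close>

definition ramp :: "real \<Rightarrow> real" where
  "ramp x = (max 0 x)\<^sup>2 / ((max 0 x)\<^sup>2 + (max 0 (1 - x))\<^sup>2)"

lemma ramp_denominator_pos: "(max 0 x)\<^sup>2 + (max 0 (1 - x))\<^sup>2 > (0::real)"
  by (cases "x > 0") (auto simp: add_pos_nonneg add_nonneg_pos)

lemma ramp_eq_0: "x \<le> 0 \<Longrightarrow> ramp x = 0"
  by (simp add: ramp_def max_def)

lemma ramp_eq_1: "1 \<le> x \<Longrightarrow> ramp x = 1"
  by (simp add: ramp_def max_def)

lemma mono_ramp: "mono ramp"
proof
  fix x y :: real assume "x \<le> y"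
  define a b c d where abcd_def: "a = (max 0 x)\<^sup>2" "b = (max 0 (1 - x))\<^sup>2" "c = (max 0 y)\<^sup>2" "d = (max 0 (1 - y))\<^sup>2"
  have "a \<le> c" "d \<le> b" "0 \<le> a" "0 \<le> d"
    using \<open>x \<le> y\<close> by (auto simp: abcd_def intro!: power_mono)
  moreover have "a + b > 0" "c + d > 0"
    unfolding abcd_def by (rule ramp_denominator_pos)+
  moreover from calculation have "a * d \<le> c * b" by (intro mult_mono) auto
  ultimately have "a / (a + b) \<le> c / (c + d)" by (simp add: field_simps)
  then show "ramp x \<le> ramp y" by (simp add: ramp_def abcd_def)
qed

lemma differentiable_max_square: "(\<lambda>x. (max 0 x)\<^sup>2) differentiable (at (x::real))"
proof -
  have sq: "((\<lambda>x::real. x\<^sup>2) has_real_derivative 2 * x) (at x within S)" for S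
    by (auto intro!: derivative_eq_intros)
  consider "x < 0" | "x > 0" | "x = 0" by linarith
  then show ?thesis
  proof cases
    case 1
    have "((\<lambda>x::real. (max 0 x)\<^sup>2) has_real_derivative 0) (at x)"
      by (rule has_field_derivative_transform_within_open[of "\<lambda>_. 0" _ _ "{..<0}"]) (use 1 in auto)
    then show ?thesis by (auto simp: real_differentiable_def)
  next
    case 2
    have "((\<lambda>x::real. (max 0 x)\<^sup>2) has_real_derivative 2 * x) (at x)"
      by (rule has_field_derivative_transform_within_open[OF sq, of "{0<..}"]) (use 2 in auto)
    then show ?thesis by (auto simp: real_differentiable_def)
  next
    case 3
    have "((\<lambda>h::real. max 0 h) \<longlongrightarrow> 0) (at 0)"
      by (rule tendsto_eq_intros refl | simp)+
    then have "((\<lambda>h::real. (max 0 h)\<^sup>2 / h) \<longlongrightarrow> 0) (at 0)"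
      by (rule Lim_transform_eventually)
        (auto simp: eventually_at_filter max_def power2_eq_square)
    then have "((\<lambda>x::real. (max 0 x)\<^sup>2) has_real_derivative 0) (at x)"
      using 3 by (simp add: DERIV_def)
    then show ?thesis by (auto simp: real_differentiable_def)
  qed
qed

lemma differentiable_ramp: "ramp differentiable (at x)"
proof -
  have "(\<lambda>x. (max 0 (1 - x))\<^sup>2) differentiable (at (x::real))"
    using differentiable_compose[of "\<lambda>x. (max 0 x)\<^sup>2" "\<lambda>x. 1 - x" x UNIV]
    by (simp add: differentiable_max_square)
  then show ?thesis
    unfolding ramp_def[abs_def]
    using ramp_denominator_pos[of x]
    by (intro differentiable_divide differentiable_add differentiable_max_square) auto
qed

text \<open>
  The increment of \<open>\<phi>\<close> at each integer is spread over the following unit interval by a ramp; the sum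
  of these ramps agrees with \<open>\<phi>\<close> at the integers and is weakly increasing. Strictness comes from
  mixing in the linear function with the same end points. Its weight \<open>1 / n\<close> is small enough to
  move the values, which all lie between 0 and \<open>n\<close>, by at most 1.
\<close>

lemma smooth_increasing_interpolation:
  fixes \<phi> :: "nat \<Rightarrow> nat"
  assumes m: "0 < m" and n: "0 < n" and \<phi>: "mono \<phi>" "\<phi> 0 = 0" "\<phi> m = n"
  shows "\<exists>h :: real \<Rightarrow> real. strict_mono h \<and> (\<forall>t. h differentiable (at t)) \<and> h 0 = 0 \<and> h m = n \<and>
    (\<forall>i t. i < m \<longrightarrow> real i \<le> t \<longrightarrow> t \<le> real (Suc i) \<longrightarrow>
       real (\<phi> i) - 1 \<le> h t \<and> h t \<le> real (\<phi> (Suc i)) + 1)"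
proof -
  define c where "c i = real (\<phi> (Suc i)) - real (\<phi> i)" for i
  define f where "f t = (\<Sum>i<m. c i * ramp (t - real i))" for t
  define h where "h t = (1 - 1 / n) * f t + t / m" for t
  have c: "0 \<le> c i" for i
    using \<phi>(1) by (simp add: c_def monoD)
  have f_nat: "f (real k) = \<phi> k" if "k \<le> m" for k
  proof -
    have "f (real k) = (\<Sum>i<m. if i < k then c i else 0)"
      unfolding f_def
      by (intro sum.cong) (auto simp: ramp_eq_0 ramp_eq_1)
    also have "\<dots> = (\<Sum>i<k. c i)"
      using that by (intro sum.mono_neutral_cong_right) auto
    also have "\<dots> = \<phi> k"
      unfolding c_def using \<phi>(2) sum_lessThan_telescope[of "\<lambda>i. real (\<phi> i)" k] by simp
    finally show ?thesis .
  qed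
  have f_mono: "f s \<le> f t" if "s \<le> t" for s t
    unfolding f_def using that c
    by (intro sum_mono mult_left_mono monoD[OF mono_ramp]) auto
  show ?thesis
  proof (intro exI[of _ h] conjI allI impI)
    have pos: "0 \<le> 1 - 1 / real n" using n by (simp add: field_simps)
    show "strict_mono h"
    proof
      fix s t :: real assume "s < t"
      then have "s / m < t / m" using m by (simp add: divide_strict_right_mono)
      moreover have "(1 - 1 / n) * f s \<le> (1 - 1 / n) * f t"
        using \<open>s < t\<close> pos by (intro mult_left_mono f_mono) auto
      ultimately show "h s < h t" by (simp add: h_def)
    qed
    have "(\<lambda>t. ramp (t - real i)) differentiable (at t)" for i t
      using differentiable_compose[of ramp "\<lambda>t. t - real i" t UNIV]
      by (simp add: differentiable_ramp)
    then have "f differentiable (at t)" for t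
      unfolding f_def[abs_def] by (intro differentiable_sum) auto
    then show "h differentiable (at t)" for t
      unfolding h_def[abs_def] using m by (intro differentiable_add differentiable_mult differentiable_divide) auto
    show "h 0 = 0"
      using f_nat[of 0] \<phi>(2) by (simp add: h_def)
    show "h m = n"
      using f_nat[of m] \<phi>(3) m n by (simp add: h_def field_simps)
    fix i t assume i: "i < m" and t: "real i \<le> t" "t \<le> real (Suc i)"
    have "f i \<le> f t" "f t \<le> f (Suc i)"
      using t by (auto intro: f_mono)
    then have ft: "\<phi> i \<le> f t" "f t \<le> \<phi> (Suc i)"
      using f_nat[of i] f_nat[of "Suc i"] i by auto
    have "\<phi> (Suc i) \<le> n" using \<phi> i by (metis Suc_leI monoD)
    then have fn: "0 \<le> f t / n" "f t / n \<le> 1" using ft n by (auto simp: field_simps)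
    have tm: "0 \<le> t / m" "t / m \<le> 1" using t i by (auto simp: field_simps)
    have "h t = f t + (t / m - f t / n)" by (simp add: h_def algebra_simps)
    with ft fn tm show "real (\<phi> i) - 1 \<le> h t" "h t \<le> real (\<phi> (Suc i)) + 1" by linarith+
  qed
qed

lemma continuous_increasing_image_atLeastAtMost:
  fixes h :: "real \<Rightarrow> real"
  assumes "strict_mono h" "\<And>t. h differentiable (at t)" "a \<le> b"
  shows "h ` {a..b} = {h a..h b}"
proof -
  have "isCont h t" for t
    using assms(2) DERIV_isCont by (auto simp: real_differentiable_def)
  then have "\<exists>t. a \<le> t \<and> t \<le> b \<and> h t = y" if "h a \<le> y" "y \<le> h b" for y
    using IVT[of h a y b] that assms(3) by blast
  then show ?thesis
    using assms(1) by (force simp: strict_mono_less_eq)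
qed

section \<open>Words and nearness in the Cayley graph\<close>

(* membership in lists is kept atomic, so that closure rules for words apply *)
declare in_listsD [rule del] in_listsI [rule del]

lemma take_in_lists [simp]: "w \<in> lists A \<Longrightarrow> take i w \<in> lists A"
  by (auto simp: in_lists_conv_set dest: in_set_takeD)

lemma nth_in_lists [simp]: "w \<in> lists A \<Longrightarrow> i < length w \<Longrightarrow> w ! i \<in> A"
  by (simp add: in_lists_conv_set)

lemma word_val_Nil [simp]: "word_val G [] = \<one>\<^bsub>G\<^esub>"
  by (simp add: word_val_def)

lemma word_val_Cons [simp]: "word_val G (x # w) = x \<otimes>\<^bsub>G\<^esub> word_val G w"
  by (simp add: word_val_def)

lemma word_val_subgroup [simp]: "word_val (G\<lparr>carrier := S\<rparr>) w = word_val G w"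
  by (simp add: word_val_def)

lemma exits_subgroup [simp]: "exits (G\<lparr>carrier := S\<rparr>) p = exits G p"
  by (cases p) auto

lemma path_pt_subgroup [simp]: "path_pt (G\<lparr>carrier := S\<rparr>) w t = path_pt G w t"
  by (simp add: path_pt_def)

lemma async_fellow_travel_subgroup [simp]:
  "async_fellow_travel (G\<lparr>carrier := S\<rparr>) X K v w = async_fellow_travel G X K v w"
  by (simp add: async_fellow_travel_def skeleton_dist_def cayley_dist_def)

context group
begin

lemma word_val_closed [simp]: "w \<in> lists (carrier G) \<Longrightarrow> word_val G w \<in> carrier G"
  by (induction w) auto

lemma word_val_append [simp]:
  "v \<in> lists (carrier G) \<Longrightarrow> w \<in> lists (carrier G) \<Longrightarrow>
    word_val G (v @ w) = word_val G v \<otimes> word_val G w"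
  by (induction v) (auto simp: m_assoc)

lemma word_val_generate: "w \<in> lists X \<Longrightarrow> word_val G w \<in> generate G X"
  by (induction w) (auto intro: generate.intros)

text \<open>
  Unlike \<open>cayley_dist\<close>, which is a least number and meaningless where no connecting word exists,
  this relation asserts that a connecting word exists.
\<close>

definition near :: "'a set \<Rightarrow> nat \<Rightarrow> 'a \<Rightarrow> 'a \<Rightarrow> bool" where
  "near X n g g' \<longleftrightarrow> (\<exists>u\<in>lists X. length u \<le> n \<and> g \<otimes> word_val G u = g')"

end

locale symmetric_alphabet = group +
  fixes X
  assumes alphabet_closed: "X \<subseteq> carrier G"
    and alphabet_inv: "x \<in> X \<Longrightarrow> inv x \<in> X"
    and alphabet_finite: "finite X"
begin

lemma words_closed [simp]: "w \<in> lists X \<Longrightarrow> w \<in> lists (carrier G)"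
  using alphabet_closed lists_mono by blast

lemma letter_closed [simp]: "x \<in> X \<Longrightarrow> x \<in> carrier G"
  using alphabet_closed by blast

definition inv_word :: "'a list \<Rightarrow> 'a list" where
  "inv_word w = rev (map (m_inv G) w)"

lemma inv_word:
  assumes "w \<in> lists X"
  shows "inv_word w \<in> lists X" "length (inv_word w) = length w"
    "word_val G (inv_word w) = inv (word_val G w)"
proof -
  have words: "inv_word w \<in> lists X" if "w \<in> lists X" for w
    using that alphabet_inv by (auto simp: inv_word_def in_lists_conv_set)
  then show "inv_word w \<in> lists X" using assms .
  show "length (inv_word w) = length w" by (simp add: inv_word_def)
  show "word_val G (inv_word w) = inv (word_val G w)"
    using assms
  proof (induction w)
    case (Cons x w)
    then have "x \<in> carrier G" "w \<in> lists (carrier G)" "inv_word w \<in> lists (carrier G)"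
      using words by auto
    moreover have "inv_word (x # w) = inv_word w @ [inv x]" by (simp add: inv_word_def)
    ultimately show ?case using Cons by (simp add: inv_mult_group)
  qed (simp add: inv_word_def)
qed

lemma near_refl: "g \<in> carrier G \<Longrightarrow> near X n g g"
  unfolding near_def by (rule bexI[of _ "[]"]) auto

lemma near_mono: "near X n g g' \<Longrightarrow> n \<le> n' \<Longrightarrow> near X n' g g'"
  unfolding near_def by (meson order_trans)

lemma near_trans:
  assumes "near X n a b" "near X m b c" "a \<in> carrier G"
  shows "near X (n + m) a c"
proof -
  obtain u v where "u \<in> lists X" "v \<in> lists X" "length u \<le> n" "length v \<le> m"
    "a \<otimes> word_val G u = b" "b \<otimes> word_val G v = c"
    using assms by (auto simp: near_def)
  then show ?thesis
    unfolding near_def using assms(3) words_closed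
    by (intro bexI[of _ "u @ v"]) (auto simp: m_assoc)
qed

lemma near_sym:
  assumes "near X n a b" "a \<in> carrier G" shows "near X n b a"
proof -
  obtain u where "u \<in> lists X" "length u \<le> n" "a \<otimes> word_val G u = b"
    using assms by (auto simp: near_def)
  then show ?thesis
    unfolding near_def using assms(2) words_closed[of u]
    by (intro bexI[of _ "inv_word u"]) (auto simp: inv_word m_assoc)
qed

lemma near_letter: "x \<in> X \<Longrightarrow> near X 1 g (g \<otimes> x)"
  unfolding near_def using alphabet_closed by (intro bexI[of _ "[x]"]) auto

definition vertex :: "'a list \<Rightarrow> nat \<Rightarrow> 'a" where
  "vertex w i = word_val G (take i w)"

lemma vertex_Suc: "w \<in> lists X \<Longrightarrow> i < length w \<Longrightarrow> vertex w (Suc i) = vertex w i \<otimes> w ! i"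
  unfolding vertex_def by (simp add: take_Suc_conv_app_nth)

lemma vertex_closed [simp]: "w \<in> lists X \<Longrightarrow> vertex w i \<in> carrier G"
  by (simp add: vertex_def)

lemma near_vertex_Suc:
  assumes "w \<in> lists X" shows "near X 1 (vertex w i) (vertex w (Suc i))"
proof (cases "i < length w")
  case True
  then show ?thesis using assms near_letter[of "w ! i"] by (auto simp: vertex_Suc dest: nth_mem)
next
  case False
  then show ?thesis using assms near_refl by (simp add: vertex_def words_closed)
qed

lemma near_vertices:
  assumes "v \<in> lists X" "w \<in> lists X"
  shows "\<exists>n. near X n (vertex v i) (vertex w j)"
proof -
  have i: "near X (length (take i v)) \<one> (vertex v i)" and j: "near X (length (take j w)) \<one> (vertex w j)"
    unfolding near_def vertex_def
    using assms by (intro bexI[of _ "take i v"], auto) (intro bexI[of _ "take j w"], auto)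
  show ?thesis
    using near_trans[OF near_sym[OF i] j] assms by auto
qed

text \<open>
  The hypothesis makes the set of lengths non-empty, without which the least number in the
  definition of the distance says nothing.
\<close>

lemma near_cayley_dist:
  assumes "near X n g g'"
  shows "near X (cayley_dist G X g g') g g'" "cayley_dist G X g g' \<le> n"
proof -
  let ?P = "\<lambda>n. \<exists>w\<in>lists X. length w = n \<and> g \<otimes> word_val G w = g'"
  obtain k where "?P k" "k \<le> n" using assms by (auto simp: near_def)
  then show "cayley_dist G X g g' \<le> n"
    unfolding cayley_dist_def using Least_le[of ?P k] by linarith
  have "?P (cayley_dist G X g g')"
    unfolding cayley_dist_def using \<open>?P k\<close> by (rule LeastI)
  then show "near X (cayley_dist G X g g') g g'" unfolding near_def by (metis order_refl)
qed

lemma exits_path_pt: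
  assumes "w \<in> lists X" "0 \<le> t" "(g, a) \<in> exits G (path_pt G w t)"
  shows "0 \<le> a" "\<exists>i. g = vertex w i \<and> (i = nat \<lfloor>t\<rfloor> \<or> i = Suc (nat \<lfloor>t\<rfloor>))"
proof -
  have fl: "nat \<lfloor>t\<rfloor> < length w" if "t < length w" using that assms by linarith
  show "0 \<le> a" using assms frac_lt_1[of t] by (auto simp: path_pt_def split: if_splits)
  show "\<exists>i. g = vertex w i \<and> (i = nat \<lfloor>t\<rfloor> \<or> i = Suc (nat \<lfloor>t\<rfloor>))"
  proof (cases "t < length w")
    case True
    then have "g = vertex w (nat \<lfloor>t\<rfloor>) \<or> g = vertex w (nat \<lfloor>t\<rfloor>) \<otimes> w ! nat \<lfloor>t\<rfloor>"
      using assms by (auto simp: path_pt_def vertex_def)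
    then show ?thesis using vertex_Suc[OF assms(1) fl[OF True]] by metis
  next
    case False
    then have "length w \<le> nat \<lfloor>t\<rfloor>" using assms by linarith
    then show ?thesis using False assms
      by (intro exI[of _ "nat \<lfloor>t\<rfloor>"]) (auto simp: path_pt_def vertex_def)
  qed
qed

lemma finite_within_edge: "finite (within_edge p q)"
  by (cases p; cases q) auto

lemma finite_exits: "finite (exits G p)"
  by (cases p) auto

text \<open>
  Unless the two points lie on one edge, a shortest path leaves the first edge and enters the second
  at end points. Each such end point is either the last vertex passed or the next one, whence the summand 2.
\<close>

lemma near_of_skeleton_dist:
  assumes vw: "v \<in> lists X" "w \<in> lists X" and "0 \<le> t" "0 \<le> s"
    and K: "skeleton_dist G X (path_pt G v t) (path_pt G w s) \<le> K"
  shows "near X (nat \<lfloor>K\<rfloor> + 2) (vertex v (nat \<lfloor>t\<rfloor>)) (vertex w (nat \<lfloor>s\<rfloor>))"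
proof -
  let ?p = "path_pt G v t" and ?q = "path_pt G w s"
  let ?E = "(\<lambda>((g, a), (g', b)). a + real (cayley_dist G X g g') + b) ` (exits G ?p \<times> exits G ?q)"
  have "exits G ?p \<noteq> {}" "exits G ?q \<noteq> {}" by (auto simp: path_pt_def)
  then have "skeleton_dist G X ?p ?q \<in> within_edge ?p ?q \<union> ?E"
    unfolding skeleton_dist_def by (intro Min_in) (auto simp: finite_within_edge finite_exits)
  then consider "skeleton_dist G X ?p ?q \<in> within_edge ?p ?q" | "skeleton_dist G X ?p ?q \<in> ?E"
    by blast
  then show ?thesis
  proof cases
    case 1
    then have "vertex v (nat \<lfloor>t\<rfloor>) = vertex w (nat \<lfloor>s\<rfloor>)"
      by (auto simp: path_pt_def vertex_def split: if_splits)
    then show ?thesis using vw by (simp add: near_refl)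
  next
    case 2
    then obtain g a g' b where e: "(g, a) \<in> exits G ?p" "(g', b) \<in> exits G ?q"
      and d: "skeleton_dist G X ?p ?q = a + real (cayley_dist G X g g') + b" by auto
    obtain i j where i: "g = vertex v i" "i = nat \<lfloor>t\<rfloor> \<or> i = Suc (nat \<lfloor>t\<rfloor>)"
      and j: "g' = vertex w j" "j = nat \<lfloor>s\<rfloor> \<or> j = Suc (nat \<lfloor>s\<rfloor>)"
      using exits_path_pt(2) e assms by metis
    have "cayley_dist G X g g' \<le> nat \<lfloor>K\<rfloor>"
      using d K exits_path_pt(1)[OF _ _ e(1)] exits_path_pt(1)[OF _ _ e(2)] assms by linarith
    moreover have "near X (cayley_dist G X g g') g g'"
      using near_vertices[OF vw] near_cayley_dist(1) i j by blast
    ultimately have 1: "near X (nat \<lfloor>K\<rfloor>) g g'" by (rule near_mono[rotated])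
    have 2: "near X 1 (vertex v (nat \<lfloor>t\<rfloor>)) g"
      using near_vertex_Suc[OF vw(1)] near_refl[of g 1] vw i by auto
    have 3: "near X 1 g' (vertex w (nat \<lfloor>s\<rfloor>))"
      using near_sym[OF near_vertex_Suc[OF vw(2)]] near_refl[of g' 1] vw j by auto
    show ?thesis using near_trans[OF near_trans[OF 2 1] 3] vw i by (simp add: add.commute)
  qed
qed

text \<open>
  Going back to the last vertex passed costs at most 1 on either path.
\<close>

lemma skeleton_dist_of_near:
  assumes vw: "v \<in> lists X" "w \<in> lists X" and "0 \<le> t" "0 \<le> s"
    and "near X n (vertex v (nat \<lfloor>t\<rfloor>)) (vertex w (nat \<lfloor>s\<rfloor>))"
  shows "skeleton_dist G X (path_pt G v t) (path_pt G w s) \<le> n + 2"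
proof -
  have *: "\<exists>a\<le>1. (vertex u (nat \<lfloor>r\<rfloor>), a) \<in> exits G (path_pt G u r)" if "0 \<le> r" for u r
  proof (cases "r < length u")
    case True
    then show ?thesis using frac_lt_1[of r] by (auto simp: path_pt_def vertex_def intro!: exI[of _ "frac r"])
  next
    case False
    then have "length u \<le> nat \<lfloor>r\<rfloor>" using that by linarith
    then show ?thesis using False by (auto simp: path_pt_def vertex_def)
  qed
  obtain a b where "a \<le> 1" "b \<le> 1" and
    ab: "(vertex v (nat \<lfloor>t\<rfloor>), a) \<in> exits G (path_pt G v t)" "(vertex w (nat \<lfloor>s\<rfloor>), b) \<in> exits G (path_pt G w s)"
    using * assms by metis
  have "skeleton_dist G X (path_pt G v t) (path_pt G w s)
      \<le> a + real (cayley_dist G X (vertex v (nat \<lfloor>t\<rfloor>)) (vertex w (nat \<lfloor>s\<rfloor>))) + b"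
    unfolding skeleton_dist_def using ab
    by (intro Min_le) (auto simp: finite_within_edge finite_exits image_iff intro!: bexI[OF _ ab(1)] bexI[OF _ ab(2)])
  also have "\<dots> \<le> n + 2"
    using near_cayley_dist(2)[OF assms(5)] \<open>a \<le> 1\<close> \<open>b \<le> 1\<close> by linarith
  finally show ?thesis .
qed

end

section \<open>Discrete fellow travelling\<close>

context group
begin

lemma mult_inv_cancel:
  assumes "x \<in> carrier G" "y \<in> carrier G"
  shows "x \<otimes> (inv x \<otimes> y) = y" "inv x \<otimes> (x \<otimes> y) = y"
  using assms by (simp_all add: m_assoc[symmetric])

text \<open>
  A coupling of the path labelled \<open>v\<close> from \<open>\<one>\<close> with the path labelled \<open>w\<close> from \<open>b\<close>: at each step
  one of the paths advances by a letter, and \<open>b\<close> is updated to the element that leads from the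
  current vertex of the first path to that of the second. By invariance under left translation
  only this element matters. Simultaneous steps are omitted; they can be split in two at the price
  of a larger \<open>B\<close>, and without them composition needs fewer cases.
\<close>

inductive coupled :: "'a set \<Rightarrow> 'a \<Rightarrow> 'a list \<Rightarrow> 'a list \<Rightarrow> bool" for B where
  stop: "b \<in> B \<Longrightarrow> coupled B b [] []"
| left: "b \<in> B \<Longrightarrow> coupled B (inv x \<otimes> b) v w \<Longrightarrow> coupled B b (x # v) w"
| right: "b \<in> B \<Longrightarrow> coupled B (b \<otimes> y) v w \<Longrightarrow> coupled B b v (y # w)"

lemma coupled_start: "coupled B b v w \<Longrightarrow> b \<in> B"
  by (induction rule: coupled.induct) auto

lemma coupled_mono: "coupled B b v w \<Longrightarrow> B \<subseteq> B' \<Longrightarrow> coupled B' b v w"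
  by (induction rule: coupled.induct) (auto intro: coupled.intros)

text \<open>
  The second start difference is the one in which every coupling of \<open>v\<close> and \<open>w\<close> from \<open>b\<close> ends.
\<close>

lemma coupled_append:
  assumes "coupled B b v w" "coupled B (inv (word_val G v) \<otimes> b \<otimes> word_val G w) v' w'"
    and "b \<in> carrier G" "v \<in> lists (carrier G)" "w \<in> lists (carrier G)"
  shows "coupled B b (v @ v') (w @ w')"
  using assms
  by (induction rule: coupled.induct) (auto intro!: coupled.intros simp: m_assoc inv_mult_group)

lemma coupled_sym:
  assumes "coupled B b v w" "b \<in> carrier G" "v \<in> lists (carrier G)" "w \<in> lists (carrier G)"
  shows "coupled (m_inv G ` B) (inv b) w v"
  using assms
  by (induction rule: coupled.induct) (auto intro!: coupled.intros simp: inv_mult_group)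

text \<open>
  The two couplings are run in parallel and synchronised along the middle word \<open>v\<close>. Steps of the
  first word in the first coupling and of the last word in the second are carried out at once; when
  neither is available, both couplings advance \<open>v\<close>, which leaves the product of the differences
  unchanged.
\<close>

lemma coupled_trans:
  assumes "coupled B b u v" "coupled B' b' v w" "b \<in> carrier G" "b' \<in> carrier G"
    and "u \<in> lists (carrier G)" "v \<in> lists (carrier G)" "w \<in> lists (carrier G)"
  shows "coupled (B <#> B') (b \<otimes> b') u w"
  using assms
proof (induction arbitrary: b' w rule: coupled.induct)
  case (stop b)
  have "coupled B' b' v w \<Longrightarrow> v = [] \<Longrightarrow> b' \<in> carrier G \<Longrightarrow> w \<in> lists (carrier G) \<Longrightarrow>
      coupled (B <#> B') (b \<otimes> b') [] w" for v
    by (induction rule: coupled.induct)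
      (use stop in \<open>auto intro!: coupled.intros simp: set_mult_def m_assoc\<close>)
  then show ?case using stop by blast
next
  case (left b x u v)
  have "b \<otimes> b' \<in> B <#> B'"
    using left.hyps coupled_start[OF left.prems(1)] by (auto simp: set_mult_def)
  moreover have "coupled (B <#> B') ((inv x \<otimes> b) \<otimes> b') u w"
    using left by auto
  ultimately show ?case
    using left.prems by (auto intro: coupled.left simp: m_assoc)
next
  case (right b y u v)
  have "coupled B' b' v' w \<Longrightarrow> v' = y # v \<Longrightarrow> b' \<in> carrier G \<Longrightarrow> w \<in> lists (carrier G) \<Longrightarrow>
      coupled (B <#> B') (b \<otimes> b') u w" for v'
  proof (induction rule: coupled.induct)
    case (left b' x v' w)
    then have "coupled (B <#> B') (b \<otimes> y \<otimes> (inv x \<otimes> b')) u w"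
      using right.prems by (intro right.IH) auto
    (* both couplings advance the middle word, and the letter cancels *)
    moreover have "b \<otimes> y \<otimes> (inv x \<otimes> b') = b \<otimes> b'"
      using left right.prems by (simp add: m_assoc mult_inv_cancel)
    ultimately show ?case by simp
  next
    case (right b' z v' w)
    then have "coupled (B <#> B') (b \<otimes> b' \<otimes> z) u w"
      using \<open>b \<in> carrier G\<close> by (auto simp: m_assoc)
    moreover have "b \<otimes> b' \<in> B <#> B'"
      using \<open>b \<in> B\<close> \<open>b' \<in> B'\<close> by (auto simp: set_mult_def)
    ultimately show ?case by (auto intro: coupled.right)
  qed auto
  then show ?case using right.prems by blast
qed

lemma coupled_exists:
  assumes "b \<in> carrier G" "v \<in> lists (carrier G)" "w \<in> lists (carrier G)"
  shows "\<exists>B. finite B \<and> B \<subseteq> carrier G \<and> coupled B b v w"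
  using assms
proof (induction v arbitrary: b)
  case Nil
  then show ?case
  proof (induction w arbitrary: b)
    case Nil
    then show ?case by (intro exI[of _ "{b}"]) (auto intro: coupled.intros)
  next
    case (Cons y w)
    then obtain B where "finite B" "B \<subseteq> carrier G" "coupled B (b \<otimes> y) [] w"
      using Cons.IH[of "b \<otimes> y"] by auto
    with Cons.prems show ?case
      by (intro exI[of _ "insert b B"]) (auto intro!: coupled.right intro: coupled_mono)
  qed
next
  case (Cons x v)
  from Cons.IH[of "inv x \<otimes> b"] Cons.prems
  obtain B where "finite B" "B \<subseteq> carrier G" "coupled B (inv x \<otimes> b) v w" by auto
  with Cons.prems show ?case
    by (intro exI[of _ "insert b B"]) (auto intro!: coupled.left intro: coupled_mono)
qed

lemma coupled_Nil_left:
  assumes "coupled B b [] w" "b \<in> carrier G" "w \<in> lists (carrier G)" "j \<le> length w"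
  shows "b \<otimes> word_val G (take j w) \<in> B"
proof -
  have "coupled B b v w \<Longrightarrow> v = [] \<Longrightarrow> b \<in> carrier G \<Longrightarrow> w \<in> lists (carrier G) \<Longrightarrow>
      j \<le> length w \<Longrightarrow> b \<otimes> word_val G (take j w) \<in> B" for v
  proof (induction arbitrary: j rule: coupled.induct)
    case (right b y v w)
    show ?case
    proof (cases j)
      case 0
      then show ?thesis using right by simp
    next
      case (Suc k)
      then show ?thesis using right.IH[of k] right.prems by (simp add: m_assoc)
    qed
  qed auto
  then show ?thesis using assms by blast
qed

definition difference :: "'a \<Rightarrow> 'a list \<Rightarrow> 'a list \<Rightarrow> nat \<Rightarrow> nat \<Rightarrow> 'a" where
  "difference b v w i j = inv (word_val G (take i v)) \<otimes> b \<otimes> word_val G (take j w)"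

text \<open>
  For \<open>i < length v\<close>, \<open>\<phi> i\<close> is the position in \<open>w\<close> at which the coupling arrives at the \<open>i\<close>-th
  vertex of \<open>v\<close>. All vertices of \<open>w\<close> passed between two consecutive arrivals are coupled with the
  earlier vertex, and the vertex at the arrival with the later one too. The last value is
  \<open>length w\<close> instead, so that all of \<open>w\<close> is covered; the vertices added to the last interval are
  coupled with the end of \<open>v\<close>.
\<close>

lemma coupled_step_map:
  assumes "coupled B b v w" "v \<noteq> []" "b \<in> carrier G" "v \<in> lists (carrier G)" "w \<in> lists (carrier G)"
  shows "\<exists>\<phi> :: nat \<Rightarrow> nat. mono \<phi> \<and> \<phi> 0 = 0 \<and> \<phi> (length v) = length w \<and>
    (\<forall>i<length v. \<forall>j\<in>{\<phi> i..\<phi> (Suc i)}. difference b v w i j \<in> B \<or> difference b v w (Suc i) j \<in> B)"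
  using assms
proof (induction rule: coupled.induct)
  case (left b x v w)
  have shift: "difference b (x # v) w (Suc i) j = difference (inv x \<otimes> b) v w i j" for i j
    using left.prems by (simp add: difference_def inv_mult_group m_assoc)
  have b: "difference b (x # v) w 0 0 \<in> B"
    using left by (simp add: difference_def)
  show ?case
  proof (cases "v = []")
    case True
    (* the last letter of the first word: the whole of the other word is passed *)
    define \<phi> where "\<phi> i = (if i = 0 then 0 else length w)" for i :: nat
    have "inv x \<otimes> b \<otimes> word_val G (take j w) \<in> B" if "j \<le> length w" for j
      using left True that by (intro coupled_Nil_left) auto
    then have "difference b (x # v) w (Suc 0) j \<in> B" if "j \<le> length w" for j
      using that unfolding shift using left.prems by (simp add: difference_def True)
    then show ?thesis
      using True by (intro exI[of _ \<phi>]) (auto simp: \<phi>_def mono_def)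
  next
    case False
    then obtain \<phi> where \<phi>: "mono \<phi>" "\<phi> 0 = 0" "\<phi> (length v) = length w"
      and d: "\<And>i j. i < length v \<Longrightarrow> j \<in> {\<phi> i..\<phi> (Suc i)} \<Longrightarrow>
        difference (inv x \<otimes> b) v w i j \<in> B \<or> difference (inv x \<otimes> b) v w (Suc i) j \<in> B"
      using left by auto
    define \<psi> where "\<psi> i = (case i of 0 \<Rightarrow> 0 | Suc k \<Rightarrow> \<phi> k)" for i
    have "mono \<psi>"
      using \<phi>(1) by (auto simp: \<psi>_def mono_iff_le_Suc split: nat.splits)
    moreover have "difference b (x # v) w i j \<in> B \<or> difference b (x # v) w (Suc i) j \<in> B"
      if "i < length (x # v)" "j \<in> {\<psi> i..\<psi> (Suc i)}" for i j
      using that b d[of "i - 1" j] \<phi>(2) unfolding shift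
      by (cases i) (auto simp: \<psi>_def shift)
    moreover have "\<psi> 0 = 0" "\<psi> (length (x # v)) = length w"
      using \<phi> by (auto simp: \<psi>_def)
    ultimately show ?thesis by blast
  qed
next
  case (right b y v w)
  have shift: "difference b v (y # w) i (Suc j) = difference (b \<otimes> y) v w i j" for i j
    using right.prems by (simp add: difference_def m_assoc)
  have b: "difference b v (y # w) 0 0 \<in> B"
    using right by (simp add: difference_def)
  obtain \<phi> where \<phi>: "mono \<phi>" "\<phi> 0 = 0" "\<phi> (length v) = length w"
    and d: "\<And>i j. i < length v \<Longrightarrow> j \<in> {\<phi> i..\<phi> (Suc i)} \<Longrightarrow>
      difference (b \<otimes> y) v w i j \<in> B \<or> difference (b \<otimes> y) v w (Suc i) j \<in> B"
    using right by auto
  define \<psi> where "\<psi> i = (case i of 0 \<Rightarrow> 0 | Suc k \<Rightarrow> Suc (\<phi> i))" for i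
  have "mono \<psi>"
    using \<phi>(1) by (auto simp: \<psi>_def mono_iff_le_Suc split: nat.splits)
  moreover have "difference b v (y # w) i j \<in> B \<or> difference b v (y # w) (Suc i) j \<in> B"
    if "i < length v" "j \<in> {\<psi> i..\<psi> (Suc i)}" for i j
  proof (cases j)
    case 0
    then show ?thesis using that b by (cases i) (auto simp: \<psi>_def)
  next
    case (Suc k)
    then show ?thesis using that d[of i k] \<phi>(2) by (cases i) (auto simp: \<psi>_def shift)
  qed
  moreover have "\<psi> 0 = 0" "\<psi> (length v) = length (y # w)"
    using \<phi> right.prems by (auto simp: \<psi>_def split: nat.splits)
  ultimately show ?case by blast
qed auto

end

context symmetric_alphabet
begin

lemma finite_ball: "finite (word_val G ` {u \<in> lists X. length u \<le> n})"
  using finite_lists_length_le[OF alphabet_finite, of n] by (simp add: lists_eq_set)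

lemma near_imp_ball:
  assumes "near X n g g'" "g \<in> carrier G"
  shows "inv g \<otimes> g' \<in> word_val G ` {u \<in> lists X. length u \<le> n}"
proof -
  obtain u where u: "u \<in> lists X" "length u \<le> n" "g' = g \<otimes> word_val G u"
    using assms by (auto simp: near_def)
  then have "inv g \<otimes> g' = word_val G u"
    using assms(2) by (simp add: m_assoc[symmetric])
  then show ?thesis using u by auto
qed

text \<open>
  Time runs through the moments at which \<open>v\<close> or its partner \<open>w\<close> reaches a vertex. At such a moment
  the last vertices passed are within \<open>\<lfloor>K\<rfloor> + 2\<close> of each other. If both paths reach a vertex at the same
  moment, then \<open>v\<close> advances first, and the intermediate pair of vertices accounts for the
  additional 1.
\<close>

lemma coupled_of_async_fellow_travel:
  assumes vw: "v \<in> lists X" "w \<in> lists X" and async: "async_fellow_travel G X K v w"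
  shows "coupled (word_val G ` {u \<in> lists X. length u \<le> nat \<lfloor>K\<rfloor> + 3}) \<one> v w"
proof -
  let ?B = "word_val G ` {u \<in> lists X. length u \<le> nat \<lfloor>K\<rfloor> + 3}"
  let ?m = "length v" and ?n = "length w"
  obtain h where h: "strict_mono h" "\<And>t. h differentiable (at t)"
    and img: "h ` {0..real ?m} = {0..real ?n}"
    and K: "\<And>t. t > 0 \<Longrightarrow> skeleton_dist G X (path_pt G v t) (path_pt G w (h t)) \<le> K"
    using async by (auto simp: async_fellow_travel_def)
  have "{h 0..h ?m} = {0..real ?n}"
    using continuous_increasing_image_atLeastAtMost[OF h, of 0 ?m] img by simp
  then have h0: "h 0 = 0" and hm: "h ?m = ?n"
    using Icc_eq_Icc[of "h 0" "h ?m" 0 "real ?n"] by auto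
  have h_nonneg: "0 \<le> h t" if "0 \<le> t" for t
    using that h0 strict_mono_less_eq[OF h(1), of 0 t] by simp
  have close: "near X (nat \<lfloor>K\<rfloor> + 2) (vertex v (nat \<lfloor>t\<rfloor>)) (vertex w (nat \<lfloor>h t\<rfloor>))" if "0 \<le> t" for t
  proof (cases "t = 0")
    case True
    then show ?thesis using near_refl[of \<one>] by (simp add: h0 vertex_def)
  next
    case False
    then show ?thesis using near_of_skeleton_dist[OF vw] that h_nonneg K by simp
  qed
  have ball: "inv (vertex v i) \<otimes> vertex w j \<in> ?B" if "near X (nat \<lfloor>K\<rfloor> + 3) (vertex v i) (vertex w j)" for i j
    using near_imp_ball[OF that] vw by simp
  have left: "coupled ?B (inv (vertex v i) \<otimes> vertex w j) (drop i v) (drop j w)"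
    if "i < ?m" "near X (nat \<lfloor>K\<rfloor> + 3) (vertex v i) (vertex w j)"
      "coupled ?B (inv (vertex v (Suc i)) \<otimes> vertex w j) (drop (Suc i) v) (drop j w)" for i j
  proof -
    have "inv (vertex v (Suc i)) \<otimes> vertex w j = inv (v ! i) \<otimes> (inv (vertex v i) \<otimes> vertex w j)"
      using that vw by (simp add: vertex_Suc inv_mult_group m_assoc)
    then show ?thesis
      using that ball by (simp add: Cons_nth_drop_Suc[symmetric] coupled.left)
  qed
  have right: "coupled ?B (inv (vertex v i) \<otimes> vertex w j) (drop i v) (drop j w)"
    if "j < ?n" "near X (nat \<lfloor>K\<rfloor> + 3) (vertex v i) (vertex w j)"
      "coupled ?B (inv (vertex v i) \<otimes> vertex w (Suc j)) (drop i v) (drop (Suc j) w)" for i j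
  proof -
    have "inv (vertex v i) \<otimes> vertex w (Suc j) = inv (vertex v i) \<otimes> vertex w j \<otimes> w ! j"
      using that vw by (simp add: vertex_Suc m_assoc)
    then show ?thesis
      using that ball by (simp add: Cons_nth_drop_Suc[symmetric] coupled.right)
  qed
  have "coupled ?B (inv (vertex v (nat \<lfloor>t\<rfloor>)) \<otimes> vertex w (nat \<lfloor>h t\<rfloor>)) (drop (nat \<lfloor>t\<rfloor>) v) (drop (nat \<lfloor>h t\<rfloor>) w)"
    if "0 \<le> t" "t \<le> ?m" for t :: real
    using that
  proof (induction "?m - nat \<lfloor>t\<rfloor> + (?n - nat \<lfloor>h t\<rfloor>)" arbitrary: t rule: less_induct)
    case (less t)
    let ?i = "nat \<lfloor>t\<rfloor>" and ?j = "nat \<lfloor>h t\<rfloor>"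
    have near: "near X (nat \<lfloor>K\<rfloor> + 3) (vertex v ?i) (vertex w ?j)"
      using close[OF \<open>0 \<le> t\<close>] by (rule near_mono) simp
    show ?case
    proof (cases "t = ?m")
      case True
      then show ?thesis using ball[OF near] by (simp add: hm coupled.stop)
    next
      case False
      then have t: "t < ?m" using less by simp
      then have ht: "h t < ?n" using strict_mono_less[OF h(1), of t ?m] hm by simp
      have i: "?i < ?m" "?i \<le> t" "t < ?i + 1" using t \<open>0 \<le> t\<close> by linarith+
      have j: "?j < ?n" "?j \<le> h t" "h t < ?j + 1" using ht h_nonneg[OF \<open>0 \<le> t\<close>] by linarith+
      (* s is the moment at which w reaches its next vertex; v reaches its next one at time Suc ?i *)
      have "real (Suc ?j) \<in> h ` {0..real ?m}" unfolding img using j by auto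
      then obtain s :: real where s: "0 \<le> s" "s \<le> ?m" "h s = Suc ?j" by auto
      have "h t < h s" using j s by simp
      then have "t < s" using strict_mono_less[OF h(1)] by blast
      consider (a) "real (Suc ?i) < s" | (b) "s < Suc ?i" | (c) "s = Suc ?i" by linarith
      then show ?thesis
      proof cases
        case a
        let ?t = "real (Suc ?i)"
        have "h t \<le> h ?t" "h ?t < h s"
          using a i strict_mono_less_eq[OF h(1), of t ?t] strict_mono_less[OF h(1), of ?t s] by auto
        then have fl: "nat \<lfloor>?t\<rfloor> = Suc ?i" "nat \<lfloor>h ?t\<rfloor> = ?j" using j s by linarith+
        have "coupled ?B (inv (vertex v (Suc ?i)) \<otimes> vertex w ?j) (drop (Suc ?i) v) (drop ?j w)"
        proof -
          have "?m - Suc ?i + (?n - ?j) < ?m - ?i + (?n - ?j)" "0 \<le> ?t" "?t \<le> ?m" using i by linarith+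
          then show ?thesis using less.hyps[of ?t, unfolded fl] by blast
        qed
        then show ?thesis using left near i by blast
      next
        case b
        have fl: "nat \<lfloor>s\<rfloor> = ?i" "nat \<lfloor>h s\<rfloor> = Suc ?j" using b i s \<open>t < s\<close> by linarith+
        have "coupled ?B (inv (vertex v ?i) \<otimes> vertex w (Suc ?j)) (drop ?i v) (drop (Suc ?j) w)"
        proof -
          have "?m - ?i + (?n - Suc ?j) < ?m - ?i + (?n - ?j)" using j(1) by arith
          then show ?thesis using less.hyps[of s, unfolded fl] s(1,2) by blast
        qed
        then show ?thesis using right near j by blast
      next
        case c
        have fl: "nat \<lfloor>s\<rfloor> = Suc ?i" "nat \<lfloor>h s\<rfloor> = Suc ?j" using c s by linarith+
        have "coupled ?B (inv (vertex v (Suc ?i)) \<otimes> vertex w (Suc ?j)) (drop (Suc ?i) v) (drop (Suc ?j) w)"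
        proof -
          have "?m - Suc ?i + (?n - Suc ?j) < ?m - ?i + (?n - ?j)" using i(1) j(1) by arith
          then show ?thesis using less.hyps[of s, unfolded fl] s(1,2) by blast
        qed
        moreover have "near X (nat \<lfloor>K\<rfloor> + 3) (vertex v (Suc ?i)) (vertex w ?j)"
          using near_trans[OF near_sym[OF near_vertex_Suc] close] vw \<open>0 \<le> t\<close>
          by (simp add: numeral_3_eq_3)
        ultimately show ?thesis using left right near i j by blast
      qed
    qed
  qed
  from this[of 0] show ?thesis by (simp add: h0 vertex_def)
qed

text \<open>
  Interpolating the step map of the coupling gives the reparametrisation. At time \<open>t\<close> the other path
  is, up to one edge, at a vertex coupled with one of the two vertices adjacent to time \<open>t\<close>.
\<close>

lemma async_fellow_travel_of_coupled:
  assumes "finite B"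
  shows "\<exists>K. \<forall>v\<in>lists X. \<forall>w\<in>lists X. v \<noteq> [] \<longrightarrow> w \<noteq> [] \<longrightarrow> coupled B \<one> v w \<longrightarrow>
    async_fellow_travel G X K v w"
proof -
  (* elements of B that are not products of letters never occur as differences,
     so they may be given an arbitrary length bound *)
  have "\<forall>b\<in>B. \<exists>k. (\<exists>n. near X n \<one> b) \<longrightarrow> near X k \<one> b" by blast
  from bchoice[OF this] obtain f where f: "\<And>b n. b \<in> B \<Longrightarrow> near X n \<one> b \<Longrightarrow> near X (f b) \<one> b" by blast
  define N where "N = sum f B"
  have fN: "f b \<le> N" if "b \<in> B" for b
    unfolding N_def using member_le_sum[of b B f] that assms by auto
  have "async_fellow_travel G X (real (N + 2) + 2) v w"
    if vw: "v \<in> lists X" "w \<in> lists X" and ne: "v \<noteq> []" "w \<noteq> []" and c: "coupled B \<one> v w" for v w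
  proof -
    let ?m = "length v" and ?n = "length w"
    obtain \<phi> where \<phi>: "mono \<phi>" "\<phi> 0 = 0" "\<phi> ?m = ?n"
      and "\<forall>i<?m. \<forall>j\<in>{\<phi> i..\<phi> (Suc i)}.
        difference \<one> v w i j \<in> B \<or> difference \<one> v w (Suc i) j \<in> B"
      using coupled_step_map[OF c ne(1) one_closed] words_closed[OF vw(1)] words_closed[OF vw(2)] by blast
    then have d: "difference \<one> v w i j \<in> B \<or> difference \<one> v w (Suc i) j \<in> B"
      if "i < ?m" "\<phi> i \<le> j" "j \<le> \<phi> (Suc i)" for i j
      using that by simp
    have m: "0 < ?m" and n: "0 < ?n" using ne by auto
    obtain h :: "real \<Rightarrow> real" where h: "strict_mono h" "\<And>t. h differentiable (at t)" "h 0 = 0" "h ?m = ?n"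
      and h\<phi>: "\<And>i t. i < ?m \<Longrightarrow> real i \<le> t \<Longrightarrow> t \<le> real (Suc i) \<Longrightarrow>
        real (\<phi> i) - 1 \<le> h t \<and> h t \<le> real (\<phi> (Suc i)) + 1"
      using smooth_increasing_interpolation[OF m n \<phi>] by auto
    have near: "near X N (vertex v i) (vertex w j)" if "difference \<one> v w i j \<in> B" for i j
    proof -
      let ?d = "difference \<one> v w i j"
      have d_eq: "?d = inv (vertex v i) \<otimes> vertex w j"
        using vw by (simp add: difference_def vertex_def)
      obtain k where "near X k (vertex v i) (vertex w j)" using near_vertices[OF vw] by blast
      then obtain u where u: "u \<in> lists X" "word_val G u = ?d" "length u \<le> k"
        using near_imp_ball vw unfolding d_eq by force
      then have "near X k \<one> ?d"
        unfolding near_def d_eq using vw by (intro bexI[of _ u]) auto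
      then have "near X N \<one> ?d" using f fN near_mono that by blast
      then obtain u where u: "u \<in> lists X" "length u \<le> N" "word_val G u = ?d"
        by (auto simp: near_def)
      then show ?thesis
        unfolding near_def using vw
        by (intro bexI[of _ u]) (auto simp: d_eq mult_inv_cancel)
    qed
    have near': "near X (N + 1) (vertex v i) (vertex w j) \<and> near X (N + 1) (vertex v (Suc i)) (vertex w j)"
      if "i < ?m" "\<phi> i \<le> j" "j \<le> \<phi> (Suc i)" for i j
    proof -
      have step: "near X 1 (vertex v i) (vertex v (Suc i))" "near X 1 (vertex v (Suc i)) (vertex v i)"
        using near_vertex_Suc near_sym vw(1) by auto
      from d[OF that] show ?thesis
      proof
        assume "difference \<one> v w i j \<in> B"
        then have "near X N (vertex v i) (vertex w j)" by (rule near)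
        then show ?thesis
          using near_trans[OF step(2)] near_mono[of N _ _ "N + 1"] vw(1) by simp
      next
        assume "difference \<one> v w (Suc i) j \<in> B"
        then have "near X N (vertex v (Suc i)) (vertex w j)" by (rule near)
        then show ?thesis
          using near_trans[OF step(1)] near_mono[of N _ _ "N + 1"] vw(1) by simp
      qed
    qed
    have near'': "near X (N + 2) (vertex v (nat \<lfloor>t\<rfloor>)) (vertex w (nat \<lfloor>h t\<rfloor>))" if "0 < t" for t
    proof (cases "t < ?m")
      case True
      define i l where "i = nat \<lfloor>t\<rfloor>" and "l = nat \<lfloor>h t\<rfloor>"
      have i: "i < ?m" "i \<le> t" "t \<le> Suc i" using True that unfolding i_def by linarith+
      have "0 \<le> h t" using h(3) strict_mono_less_eq[OF h(1), of 0 t] that by simp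
      then have l: "\<phi> i \<le> Suc l" "l \<le> Suc (\<phi> (Suc i))"
        using h\<phi>[OF i] unfolding l_def by linarith+
      have "\<phi> i \<le> \<phi> (Suc i)" using \<phi>(1) by (simp add: monoD)
      (* the interpolation misses the interval of the step map by at most 1 *)
      define j where "j = max (\<phi> i) (min l (\<phi> (Suc i)))"
      have j: "\<phi> i \<le> j" "j \<le> \<phi> (Suc i)" "l = j \<or> l = Suc j \<or> j = Suc l"
        using l \<open>\<phi> i \<le> \<phi> (Suc i)\<close> by (auto simp: j_def)
      then have "near X 1 (vertex w j) (vertex w l)"
        using near_vertex_Suc[OF vw(2)] near_sym[OF near_vertex_Suc[OF vw(2)]] near_refl vw(2) by auto
      then have "near X (N + 1 + 1) (vertex v i) (vertex w l)"
        using near'[OF i(1) j(1,2)] vertex_closed[OF vw(1)] by (blast intro: near_trans)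
      then show ?thesis by (simp add: i_def l_def)
    next
      case False
      then have "?n \<le> h t" using h(4) strict_mono_less_eq[OF h(1), of ?m t] by simp
      with False have "?m \<le> nat \<lfloor>t\<rfloor>" "?n \<le> nat \<lfloor>h t\<rfloor>" by linarith+
      then have end_eq: "vertex v (nat \<lfloor>t\<rfloor>) = vertex v ?m" "vertex w (nat \<lfloor>h t\<rfloor>) = vertex w ?n"
        by (auto simp: vertex_def)
      have "\<phi> (?m - 1) \<le> ?n" using \<phi> monoD[of \<phi> "?m - 1" ?m] by simp
      then have "near X (N + 1) (vertex v ?m) (vertex w ?n)"
        using near'[of "?m - 1" ?n] m \<phi>(3) by simp
      then show ?thesis unfolding end_eq by (rule near_mono) simp
    qed
    have "h ` {0..real ?m} = {0..real ?n}"
      using continuous_increasing_image_atLeastAtMost[OF h(1,2), of 0 ?m] h(3,4) by simp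
    moreover have "skeleton_dist G X (path_pt G v t) (path_pt G w (h t)) \<le> real (N + 2) + 2" if "0 < t" for t
    proof -
      have "0 \<le> h t" using h(3) strict_mono_less_eq[OF h(1), of 0 t] that by simp
      then show ?thesis using skeleton_dist_of_near[OF vw _ _ near''[OF that]] that by simp
    qed
    ultimately show ?thesis
      unfolding async_fellow_travel_def using h by blast
  qed
  then show ?thesis by blast
qed

end

section \<open>Families with a common finite set of differences\<close>

context group
begin

text \<open>
  A relation between a start difference and two words, all of whose instances are coupled with
  differences in one finite set. The closure properties below replace all computations with
  fellow travelling constants.
\<close>

definition uniformly_coupled :: "('a \<Rightarrow> 'a list \<Rightarrow> 'a list \<Rightarrow> bool) \<Rightarrow> bool" where
  "uniformly_coupled R \<longleftrightarrow> (\<exists>B. finite B \<and> B \<subseteq> carrier G \<and>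
     (\<forall>b v w. R b v w \<longrightarrow> v \<in> lists (carrier G) \<and> w \<in> lists (carrier G) \<and> coupled B b v w))"

lemma uniformly_coupledD:
  assumes "uniformly_coupled R"
  shows "\<exists>B. finite B \<and> B \<subseteq> carrier G \<and> (\<forall>b v w. R b v w \<longrightarrow>
    b \<in> carrier G \<and> v \<in> lists (carrier G) \<and> w \<in> lists (carrier G) \<and> coupled B b v w)"
proof -
  obtain B where B: "finite B" "B \<subseteq> carrier G"
    and R: "\<forall>b v w. R b v w \<longrightarrow> v \<in> lists (carrier G) \<and> w \<in> lists (carrier G) \<and> coupled B b v w"
    using assms unfolding uniformly_coupled_def by blast
  moreover have "b \<in> carrier G" if "R b v w" for b v w
    using R that B(2) coupled_start by blast
  ultimately show ?thesis by (intro exI[of _ B]) simp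
qed

lemma uniformly_coupled_mono:
  assumes "uniformly_coupled R" "\<And>b v w. R' b v w \<Longrightarrow> R b v w"
  shows "uniformly_coupled R'"
  using assms unfolding uniformly_coupled_def by meson

lemma uniformly_coupled_UN:
  assumes "finite I" "\<And>i. i \<in> I \<Longrightarrow> uniformly_coupled (R i)"
  shows "uniformly_coupled (\<lambda>b v w. \<exists>i\<in>I. R i b v w)"
proof -
  define bound where "bound B R \<longleftrightarrow> finite B \<and> B \<subseteq> carrier G \<and>
     (\<forall>b v w. R b v w \<longrightarrow> v \<in> lists (carrier G) \<and> w \<in> lists (carrier G) \<and> coupled B b v w)" for B R
  have "\<forall>i\<in>I. \<exists>B. bound B (R i)"
    using assms(2) unfolding uniformly_coupled_def bound_def by blast
  from bchoice[OF this] obtain B where "\<forall>i\<in>I. bound (B i) (R i)" ..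
  then have B: "finite (B i)" "B i \<subseteq> carrier G"
    "R i b v w \<Longrightarrow> v \<in> lists (carrier G) \<and> w \<in> lists (carrier G) \<and> coupled (B i) b v w"
    if "i \<in> I" for i b v w
    using that unfolding bound_def by simp_all
  show ?thesis
    unfolding uniformly_coupled_def
  proof (intro exI[of _ "\<Union>i\<in>I. B i"] conjI allI impI)
    show "finite (\<Union>i\<in>I. B i)" "(\<Union>i\<in>I. B i) \<subseteq> carrier G" using assms(1) B by auto
    fix b v w assume "\<exists>i\<in>I. R i b v w"
    then obtain i where i: "i \<in> I" "R i b v w" by blast
    then show "v \<in> lists (carrier G)" "w \<in> lists (carrier G)" using B(3) by blast+
    show "coupled (\<Union>i\<in>I. B i) b v w"
      using B(3)[OF i] i(1) by (auto intro: coupled_mono[of "B i"])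
  qed
qed

lemma uniformly_coupled_single:
  assumes "b \<in> carrier G" "v \<in> lists (carrier G)" "w \<in> lists (carrier G)"
  shows "uniformly_coupled (\<lambda>b' v' w'. b' = b \<and> v' = v \<and> w' = w)"
  using coupled_exists[OF assms] assms unfolding uniformly_coupled_def by blast

lemma uniformly_coupled_trans:
  assumes "uniformly_coupled R" "uniformly_coupled S"
  shows "uniformly_coupled (\<lambda>b u w. \<exists>b1 b2 v. b = b1 \<otimes> b2 \<and> R b1 u v \<and> S b2 v w)"
proof -
  obtain B where B: "finite B" "B \<subseteq> carrier G" and R: "\<And>b v w. R b v w \<Longrightarrow>
      b \<in> carrier G \<and> v \<in> lists (carrier G) \<and> w \<in> lists (carrier G) \<and> coupled B b v w"
    using uniformly_coupledD[OF assms(1)] by blast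
  obtain C where C: "finite C" "C \<subseteq> carrier G" and S: "\<And>b v w. S b v w \<Longrightarrow>
      b \<in> carrier G \<and> v \<in> lists (carrier G) \<and> w \<in> lists (carrier G) \<and> coupled C b v w"
    using uniformly_coupledD[OF assms(2)] by blast
  have "finite (B <#> C)" using B C by (auto simp: set_mult_def)
  moreover have "B <#> C \<subseteq> carrier G" using B C by (intro set_mult_closed)
  ultimately show ?thesis
    unfolding uniformly_coupled_def
    by (intro exI[of _ "B <#> C"]) (auto dest!: R S intro: coupled_trans)
qed

lemma uniformly_coupled_sym:
  assumes "uniformly_coupled R"
  shows "uniformly_coupled (\<lambda>b v w. \<exists>b'. b = inv b' \<and> R b' w v)"
proof -
  obtain B where B: "finite B" "B \<subseteq> carrier G" and R: "\<And>b v w. R b v w \<Longrightarrow>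
      b \<in> carrier G \<and> v \<in> lists (carrier G) \<and> w \<in> lists (carrier G) \<and> coupled B b v w"
    using uniformly_coupledD[OF assms(1)] by blast
  then show ?thesis
    unfolding uniformly_coupled_def
    by (intro exI[of _ "m_inv G ` B"]) (auto dest!: R intro: coupled_sym)
qed

lemma uniformly_coupled_append:
  assumes "uniformly_coupled R" "uniformly_coupled S"
  shows "uniformly_coupled (\<lambda>b v w. \<exists>v1 v2 w1 w2. v = v1 @ v2 \<and> w = w1 @ w2 \<and> R b v1 w1 \<and>
    S (inv (word_val G v1) \<otimes> b \<otimes> word_val G w1) v2 w2)"
proof -
  obtain B where B: "finite B" "B \<subseteq> carrier G" and R: "\<And>b v w. R b v w \<Longrightarrow>
      b \<in> carrier G \<and> v \<in> lists (carrier G) \<and> w \<in> lists (carrier G) \<and> coupled B b v w"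
    using uniformly_coupledD[OF assms(1)] by blast
  obtain C where C: "finite C" "C \<subseteq> carrier G" and S: "\<And>b v w. S b v w \<Longrightarrow>
      b \<in> carrier G \<and> v \<in> lists (carrier G) \<and> w \<in> lists (carrier G) \<and> coupled C b v w"
    using uniformly_coupledD[OF assms(2)] by blast
  show ?thesis
    unfolding uniformly_coupled_def
  proof (intro exI[of _ "B \<union> C"] conjI allI impI)
    fix b v w
    assume "\<exists>v1 v2 w1 w2. v = v1 @ v2 \<and> w = w1 @ w2 \<and> R b v1 w1 \<and>
      S (inv (word_val G v1) \<otimes> b \<otimes> word_val G w1) v2 w2"
    then obtain v1 v2 w1 w2 where e: "v = v1 @ v2" "w = w1 @ w2" and r: "R b v1 w1"
      and s: "S (inv (word_val G v1) \<otimes> b \<otimes> word_val G w1) v2 w2" by blast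
    show "v \<in> lists (carrier G)" "w \<in> lists (carrier G)" using R[OF r] S[OF s] e by auto
    show "coupled (B \<union> C) b v w"
      unfolding e using R[OF r] S[OF s]
      by (intro coupled_append) (auto intro: coupled_mono)
  qed (use B C in auto)
qed

text \<open>
  Finitely many letters are needed because reading \<open>v\<close> against itself one step at a time passes through
  the inverses of its letters.
\<close>

lemma uniformly_coupled_refl:
  assumes "finite A" "A \<subseteq> carrier G"
  shows "uniformly_coupled (\<lambda>b v w. b = \<one> \<and> w = v \<and> v \<in> lists A)"
proof -
  have "coupled (insert \<one> (m_inv G ` A)) \<one> v v" if "v \<in> lists A" for v
    using that
  proof (induction v)
    case (Cons x v)
    then have "x \<in> carrier G" "inv x \<in> m_inv G ` A" using assms by auto
    then show ?case using Cons by (intro coupled.left coupled.right) auto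
  qed (auto intro: coupled.intros)
  then show ?thesis
    unfolding uniformly_coupled_def using assms lists_mono[of A "carrier G"]
    by (intro exI[of _ "insert \<one> (m_inv G ` A)"]) auto
qed

end

lemma (in symmetric_alphabet) uniformly_coupled_async:
  "uniformly_coupled (\<lambda>b v w. b = \<one> \<and> v \<in> lists X \<and> w \<in> lists X \<and> async_fellow_travel G X K v w)"
  unfolding uniformly_coupled_def
  using coupled_of_async_fellow_travel finite_ball
  by (intro exI[of _ "word_val G ` {u \<in> lists X. length u \<le> nat \<lfloor>K\<rfloor> + 3}"]) auto

section \<open>Combings of subgroups\<close>

text \<open>
  A combing of the subgroup \<open>S\<close>, with couplings of words in the ambient group \<open>G\<close> in place of fellow
  travelling with respect to \<open>X\<close>.
\<close>

locale coupled_combing = group G for G (structure) +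
  fixes S X L
  assumes subgroup: "subgroup S G"
    and alphabet_subset: "X \<subseteq> S"
    and alphabet_inv: "x \<in> X \<Longrightarrow> inv x \<in> X"
    and alphabet_finite: "finite X"
    and words_generate: "g \<in> S \<Longrightarrow> \<exists>w\<in>lists X. word_val G w = g"
    and language_subset: "L \<subseteq> lists X"
    and language_represents: "g \<in> S \<Longrightarrow> \<exists>w\<in>L. word_val G w = g"
    and combing: "uniformly_coupled (\<lambda>b v w. b = \<one> \<and> v \<in> L \<and> w \<in> L \<and>
      (\<exists>x\<in>X \<union> {\<one>}. word_val G w = word_val G v \<otimes> x))"
begin

sublocale symmetric_alphabet G X
  using subgroup.subset[OF subgroup] alphabet_subset alphabet_inv alphabet_finite
  by unfold_locales auto

lemma word_val_mem: "w \<in> lists X \<Longrightarrow> word_val G w \<in> S"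
  using alphabet_subset
  by (induction w) (auto intro: subgroup.m_closed[OF subgroup] subgroup.one_closed[OF subgroup])

lemma language_word [simp]: "w \<in> L \<Longrightarrow> w \<in> lists X"
  using language_subset by blast

lemma language_val_mem [simp]: "w \<in> L \<Longrightarrow> word_val G w \<in> S"
  by (simp add: word_val_mem)

lemma mem_closed [simp]: "g \<in> S \<Longrightarrow> g \<in> carrier G"
  using subgroup.subset[OF subgroup] by blast

lemma mem_rules [simp]:
  "\<one> \<in> S" "g \<in> S \<Longrightarrow> inv g \<in> S" "g \<in> S \<Longrightarrow> g' \<in> S \<Longrightarrow> g \<otimes> g' \<in> S"
  using subgroup.one_closed[OF subgroup] subgroup.m_inv_closed[OF subgroup]
    subgroup.m_closed[OF subgroup] by auto

lemma letter_mem [simp]: "x \<in> X \<Longrightarrow> x \<in> S"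
  using alphabet_subset by blast

text \<open>
  Write \<open>c\<close> as a word over \<open>X\<close> and pass through representatives in \<open>L\<close> of the intermediate
  products, one for each letter.
\<close>

lemma uniformly_coupled_right_mult:
  assumes "c \<in> S"
  shows "uniformly_coupled (\<lambda>b v w. b = \<one> \<and> v \<in> L \<and> w \<in> L \<and> word_val G w = word_val G v \<otimes> c)"
proof -
  have "uniformly_coupled (\<lambda>b v w. b = \<one> \<and> v \<in> L \<and> w \<in> L \<and>
      word_val G w = word_val G v \<otimes> word_val G u)" if "u \<in> lists X" for u
    using that
  proof (induction u)
    case Nil
    show ?case by (rule uniformly_coupled_mono[OF combing]) auto
  next
    case (Cons x u)
    then have IH: "uniformly_coupled (\<lambda>b v w. b = \<one> \<and> v \<in> L \<and> w \<in> L \<and>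
      word_val G w = word_val G v \<otimes> word_val G u)" and x: "x \<in> X" and u: "u \<in> lists X" by auto
    show ?case
    proof (rule uniformly_coupled_mono[OF uniformly_coupled_trans[OF combing IH]], elim conjE)
      fix b v w
      assume *: "b = \<one>" "v \<in> L" "w \<in> L" "word_val G w = word_val G v \<otimes> word_val G (x # u)"
      have "word_val G v \<otimes> x \<in> S"
        using x * by simp
      then obtain v' where v': "v' \<in> L" "word_val G v' = word_val G v \<otimes> x"
        using language_represents by blast
      then have "word_val G w = word_val G v' \<otimes> word_val G u"
        using * x u by (simp add: m_assoc)
      then show "\<exists>b1 b2 v'. b = b1 \<otimes> b2 \<and> (b1 = \<one> \<and> v \<in> L \<and> v' \<in> L \<and>
          (\<exists>x\<in>X \<union> {\<one>}. word_val G v' = word_val G v \<otimes> x)) \<and>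
          b2 = \<one> \<and> v' \<in> L \<and> w \<in> L \<and> word_val G w = word_val G v' \<otimes> word_val G u"
        using * v' x by (intro exI[of _ \<one>] exI[of _ v']) auto
    qed
  qed
  then show ?thesis using words_generate[OF assms] by blast
qed

text \<open>
  If \<open>x\<close> is a letter and \<open>val v = x val w\<close>, then a left combing couples \<open>x\<^sup>-\<^sup>1 v\<close> with \<open>w\<close>. Removing
  the first letter of \<open>x\<^sup>-\<^sup>1 v\<close> means that \<open>w\<close> starts at \<open>x\<close> instead of \<open>\<one>\<close>. A general \<open>c\<close> is a word in
  the letters, and the start differences multiply up to \<open>c\<close>.
\<close>

lemma uniformly_coupled_left_mult:
  assumes bicombing: "uniformly_coupled (\<lambda>b v w. b = \<one> \<and>
      (\<exists>x\<in>X. \<exists>u\<in>L. v = x # u \<and> w \<in> L \<and> word_val G w = x \<otimes> word_val G u))"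
    and "c \<in> S"
  shows "uniformly_coupled (\<lambda>b v w. b = c \<and> v \<in> L \<and> w \<in> L \<and> word_val G v = c \<otimes> word_val G w)"
proof -
  have one: "uniformly_coupled (\<lambda>b v w. b = \<one> \<and> v \<in> L \<and> w \<in> L \<and> word_val G v = word_val G w)"
    by (rule uniformly_coupled_mono[OF combing]) auto
  have skip: "uniformly_coupled (\<lambda>b v w. \<exists>x\<in>X. b = x \<and> v \<in> L \<and> w = inv x # v)"
  proof -
    have "uniformly_coupled (\<lambda>b v w. \<exists>x\<in>X. b = x \<and> v = [] \<and> w = [inv x])"
      using alphabet_inv by (intro uniformly_coupled_UN alphabet_finite) (simp add: uniformly_coupled_single)
    moreover have "uniformly_coupled (\<lambda>b v w. b = \<one> \<and> w = v \<and> v \<in> lists X)"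
      by (intro uniformly_coupled_refl alphabet_finite alphabet_closed)
    ultimately show ?thesis
      by (rule uniformly_coupled_mono[OF uniformly_coupled_append])
        (force simp: alphabet_inv intro: exI[of _ "[]"])
  qed
  have letter: "uniformly_coupled (\<lambda>b v w. b \<in> X \<and> v \<in> L \<and> w \<in> L \<and> word_val G v = b \<otimes> word_val G w)"
  proof (rule uniformly_coupled_mono[OF uniformly_coupled_trans[OF skip bicombing]], elim conjE)
    fix b v w
    assume *: "b \<in> X" "v \<in> L" "w \<in> L" "word_val G v = b \<otimes> word_val G w"
    then have "word_val G w = inv b \<otimes> word_val G v" by (simp add: mult_inv_cancel)
    then show "\<exists>b1 b2 v'. b = b1 \<otimes> b2 \<and> (\<exists>x\<in>X. b1 = x \<and> v \<in> L \<and> v' = inv x # v) \<and> b2 = \<one> \<and>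
        (\<exists>x\<in>X. \<exists>u\<in>L. v' = x # u \<and> w \<in> L \<and> word_val G w = x \<otimes> word_val G u)"
      using * alphabet_inv by (intro exI[of _ b] exI[of _ \<one>] exI[of _ "inv b # v"]) auto
  qed
  have "uniformly_coupled (\<lambda>b v w. b = word_val G u \<and> v \<in> L \<and> w \<in> L \<and>
      word_val G v = word_val G u \<otimes> word_val G w)" if "u \<in> lists X" for u
    using that
  proof (induction u)
    case Nil
    show ?case by (rule uniformly_coupled_mono[OF one]) auto
  next
    case (Cons x u)
    then have IH: "uniformly_coupled (\<lambda>b v w. b = word_val G u \<and> v \<in> L \<and> w \<in> L \<and>
      word_val G v = word_val G u \<otimes> word_val G w)" and x: "x \<in> X" and u: "u \<in> lists X" by auto
    show ?case
    proof (rule uniformly_coupled_mono[OF uniformly_coupled_trans[OF letter IH]], elim conjE)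
      fix b v w
      assume *: "b = word_val G (x # u)" "v \<in> L" "w \<in> L" "word_val G v = word_val G (x # u) \<otimes> word_val G w"
      have "word_val G u \<otimes> word_val G w \<in> S"
        using u * by (simp add: word_val_mem)
      then obtain v' where v': "v' \<in> L" "word_val G v' = word_val G u \<otimes> word_val G w"
        using language_represents by blast
      then have "word_val G v = x \<otimes> word_val G v'"
        using * x u by (simp add: m_assoc)
      then show "\<exists>b1 b2 v'. b = b1 \<otimes> b2 \<and> (b1 \<in> X \<and> v \<in> L \<and> v' \<in> L \<and> word_val G v = b1 \<otimes> word_val G v') \<and>
          b2 = word_val G u \<and> v' \<in> L \<and> w \<in> L \<and> word_val G v' = word_val G u \<otimes> word_val G w"
        using * v' x by (intro exI[of _ x] exI[of _ "word_val G u"] exI[of _ v']) auto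
    qed
  qed
  then show ?thesis using words_generate[OF assms(2)] by blast
qed

end

section \<open>Products of words from the two combings\<close>

text \<open>
  The assumption on \<open>H \<inter> N\<close> covers both cases of the hypothesis: for \<open>c = \<one>\<close> it says that words in
  \<open>L\<^sub>N\<close> for the same element are coupled, and other \<open>c\<close> are provided for by a bicombing.
\<close>

locale coupled_extension = group G for G (structure) +
  fixes N H X Y L\<^sub>N L\<^sub>H
  assumes normal: "N \<lhd> G"
    and N: "coupled_combing G N X L\<^sub>N"
    and H: "coupled_combing G H Y L\<^sub>H"
    and finite_Int: "finite (H \<inter> N)"
    and left_mult_Int: "c \<in> H \<inter> N \<Longrightarrow> uniformly_coupled (\<lambda>b v w. b = c \<and> v \<in> L\<^sub>N \<and> w \<in> L\<^sub>N \<and>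
      word_val G v = c \<otimes> word_val G w)"
    and conjugation: "y \<in> Y \<Longrightarrow> uniformly_coupled (\<lambda>b v w. b = \<one> \<and> v \<in> L\<^sub>N \<and>
      (\<exists>u\<in>L\<^sub>N. word_val G v = conj_by G (word_val G u) y \<and> is_image_under G L\<^sub>N u y w))"
begin

sublocale N: coupled_combing G N X L\<^sub>N by (rule N)
sublocale H: coupled_combing G H Y L\<^sub>H by (rule H)

lemma conj_by_mem: "n \<in> N \<Longrightarrow> g \<in> carrier G \<Longrightarrow> conj_by G n g \<in> N"
  unfolding conj_by_def using normal.inv_op_closed1[OF normal] by blast

text \<open>
  Choose one representative of \<open>x\<^sup>y\<close> for each of the finitely many letters \<open>x\<close>, which determines an
  image of \<open>v\<close>. Reading \<open>x\<close> and the chosen word for \<open>x\<^sup>y\<close> from the difference \<open>y\<close> leads back to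
  the difference \<open>y\<close>, as \<open>x\<^sup>-\<^sup>1 y x\<^sup>y = y\<close>; so \<open>v\<close> is coupled with its image letter by letter. The
  image in turn is coupled with every word for the conjugate.
\<close>

lemma uniformly_coupled_conj:
  assumes y: "y \<in> Y"
  shows "uniformly_coupled (\<lambda>b v w. b = y \<and> v \<in> L\<^sub>N \<and> w \<in> L\<^sub>N \<and>
    word_val G w = conj_by G (word_val G v) y)"
proof -
  have yG: "y \<in> carrier G" using y by simp
  have "\<forall>x\<in>X. \<exists>u\<in>L\<^sub>N. word_val G u = conj_by G x y"
    using N.language_represents conj_by_mem yG N.alphabet_subset by blast
  from bchoice[OF this[unfolded Bex_def]]
  obtain img where img: "\<And>x. x \<in> X \<Longrightarrow> img x \<in> L\<^sub>N \<and> word_val G (img x) = conj_by G x y"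
    by blast
  have "uniformly_coupled (\<lambda>b v w. \<exists>x\<in>X. b = y \<and> v = [x] \<and> w = img x)"
    using img yG by (intro uniformly_coupled_UN N.alphabet_finite uniformly_coupled_single) auto
  from uniformly_coupledD[OF this] obtain B where B: "finite B" "B \<subseteq> carrier G"
    and "\<forall>b v w. (\<exists>x\<in>X. b = y \<and> v = [x] \<and> w = img x) \<longrightarrow>
      b \<in> carrier G \<and> v \<in> lists (carrier G) \<and> w \<in> lists (carrier G) \<and> coupled B b v w"
    by (elim exE conjE)
  then have letter: "coupled B y [x] (img x)" if "x \<in> X" for x
    using that by simp
  have "coupled (insert y B) y v (concat (map img v)) \<and> concat (map img v) \<in> lists (carrier G)"
    if "v \<in> lists X" for v
    using that
  proof (induction v)
    case (Cons x v)
    have "inv x \<otimes> y \<otimes> word_val G (img x) = y"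
      using Cons.hyps img[of x] yG by (simp add: conj_by_def m_assoc mult_inv_cancel)
    then have "coupled (insert y B) y ([x] @ v) (img x @ concat (map img v))"
      using Cons img[of x] yG letter[of x]
      by (intro coupled_append) (auto intro: coupled_mono)
    then show ?case using Cons img[of x] by simp
  qed (simp add: coupled.stop)
  then have image: "uniformly_coupled (\<lambda>b v w. b = y \<and> v \<in> lists X \<and> w = concat (map img v))"
    unfolding uniformly_coupled_def using B yG by (intro exI[of _ "insert y B"]) auto
  show ?thesis
  proof (rule uniformly_coupled_mono[OF uniformly_coupled_trans[OF image uniformly_coupled_sym[OF conjugation[OF y]]]],
      elim conjE)
    fix b v w
    assume *: "b = y" "v \<in> L\<^sub>N" "w \<in> L\<^sub>N" "word_val G w = conj_by G (word_val G v) y"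
    have "list_all2 (\<lambda>x u. u \<in> L\<^sub>N \<and> word_val G u = conj_by G x y) v (map img v)"
      using N.language_word[OF *(2)] img by (auto simp: list_all2_conv_all_nth)
    then have "is_image_under G L\<^sub>N v y (concat (map img v))"
      unfolding is_image_under_def by blast
    then show "\<exists>b1 b2 v'. b = b1 \<otimes> b2 \<and> (b1 = y \<and> v \<in> lists X \<and> v' = concat (map img v)) \<and>
        (\<exists>b'. b2 = inv b' \<and> b' = \<one> \<and> w \<in> L\<^sub>N \<and>
          (\<exists>u\<in>L\<^sub>N. word_val G w = conj_by G (word_val G u) y \<and> is_image_under G L\<^sub>N u y v'))"
      using * yG by (intro exI[of _ y] exI[of _ \<one>] exI[of _ "concat (map img v)"]) auto
  qed
qed

text \<open>
  Stated as a relation with a start difference, which is always \<open>\<one>\<close>, so that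
  \<open>uniformly_coupled\<close> applies.
\<close>

definition products_step :: "'a \<Rightarrow> 'a \<Rightarrow> 'a list \<Rightarrow> 'a list \<Rightarrow> bool" where
  "products_step c b p q \<longleftrightarrow> b = \<one> \<and> (\<exists>u\<in>L\<^sub>H. \<exists>v\<in>L\<^sub>N. \<exists>u'\<in>L\<^sub>H. \<exists>v'\<in>L\<^sub>N. p = u @ v \<and> q = u' @ v' \<and>
     word_val G u' \<otimes> word_val G v' = word_val G u \<otimes> word_val G v \<otimes> c)"

lemma product_mult:
  assumes "h \<in> H" "n \<in> N" "h' \<in> H" "n' \<in> N"
  shows "\<exists>k\<in>H. \<exists>m\<in>N. h \<otimes> n \<otimes> (h' \<otimes> n') = k \<otimes> m"
proof (intro bexI)
  show "h \<otimes> n \<otimes> (h' \<otimes> n') = (h \<otimes> h') \<otimes> (conj_by G n h' \<otimes> n')"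
    using assms by (simp add: conj_by_def m_assoc mult_inv_cancel)
  show "h \<otimes> h' \<in> H" using assms by simp
  show "conj_by G n h' \<otimes> n' \<in> N"
    using assms conj_by_mem by simp
qed

text \<open>
  If \<open>h n = h' n'\<close>, then \<open>c = h\<^sup>-\<^sup>1 h' = n n'\<^sup>-\<^sup>1\<close> lies in the finite group \<open>H \<inter> N\<close>. The words for \<open>h\<close>
  and \<open>h' = h c\<close> are coupled and end in the difference \<open>c\<close>, and those for \<open>n = c n'\<close> and \<open>n'\<close> are
  coupled from \<open>c\<close>.
\<close>

lemma uniformly_coupled_same_product: "uniformly_coupled (products_step \<one>)"
proof -
  have "uniformly_coupled (\<lambda>b v w. \<exists>c\<in>H \<inter> N. \<exists>v1 v2 w1 w2. v = v1 @ v2 \<and> w = w1 @ w2 \<and>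
      (b = \<one> \<and> v1 \<in> L\<^sub>H \<and> w1 \<in> L\<^sub>H \<and> word_val G w1 = word_val G v1 \<otimes> c) \<and>
      (inv (word_val G v1) \<otimes> b \<otimes> word_val G w1 = c \<and> v2 \<in> L\<^sub>N \<and> w2 \<in> L\<^sub>N \<and> word_val G v2 = c \<otimes> word_val G w2))"
    by (intro uniformly_coupled_UN finite_Int uniformly_coupled_append
        H.uniformly_coupled_right_mult left_mult_Int) auto
  then show ?thesis
  proof (rule uniformly_coupled_mono)
    fix b p q assume "products_step \<one> b p q"
    then obtain u v u' v' where w: "u \<in> L\<^sub>H" "v \<in> L\<^sub>N" "u' \<in> L\<^sub>H" "v' \<in> L\<^sub>N"
      and pq: "b = \<one>" "p = u @ v" "q = u' @ v'"
      and "word_val G u' \<otimes> word_val G v' = word_val G u \<otimes> word_val G v \<otimes> \<one>"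
      unfolding products_step_def by blast
    then have eq: "word_val G u \<otimes> word_val G v = word_val G u' \<otimes> word_val G v'" by simp
    define c where "c = inv (word_val G u) \<otimes> word_val G u'"
    have v: "word_val G v = c \<otimes> word_val G v'"
      unfolding c_def using w arg_cong[OF eq, of "\<lambda>g. inv (word_val G u) \<otimes> g"]
      by (simp add: m_assoc mult_inv_cancel)
    have cH: "c \<in> H"
      unfolding c_def using w by simp
    have "c = word_val G v \<otimes> inv (word_val G v')"
      unfolding v using w cH by (simp add: m_assoc)
    then have cN: "c \<in> N"
      using w by simp
    have u': "word_val G u' = word_val G u \<otimes> c"
      unfolding c_def using w by (simp add: mult_inv_cancel)
    have diff: "inv (word_val G u) \<otimes> b \<otimes> word_val G u' = c"
      unfolding c_def using w pq by simp
    show "\<exists>c\<in>H \<inter> N. \<exists>v1 v2 w1 w2. p = v1 @ v2 \<and> q = w1 @ w2 \<and>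
      (b = \<one> \<and> v1 \<in> L\<^sub>H \<and> w1 \<in> L\<^sub>H \<and> word_val G w1 = word_val G v1 \<otimes> c) \<and>
      (inv (word_val G v1) \<otimes> b \<otimes> word_val G w1 = c \<and> v2 \<in> L\<^sub>N \<and> w2 \<in> L\<^sub>N \<and> word_val G v2 = c \<otimes> word_val G w2)"
      by (intro bexI[of _ c] exI[of _ u] exI[of _ v] exI[of _ u'] exI[of _ v'] conjI IntI
          pq w v u' diff cH cN)
  qed
qed

text \<open>
  It suffices to couple \<open>u v\<close> with one product that represents \<open>h n x\<close>, since all others are coupled
  with that one. Keeping \<open>u\<close> and replacing \<open>v\<close> by a word for \<open>n x\<close> does this.
\<close>

lemma uniformly_coupled_products_letter_N:
  assumes x: "x \<in> X"
  shows "uniformly_coupled (products_step x)"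
proof -
  define R where "R b p q \<longleftrightarrow> (\<exists>u v u' v'. p = u @ v \<and> q = u' @ v' \<and>
      (b = \<one> \<and> u' = u \<and> u \<in> lists Y) \<and>
      (inv (word_val G u) \<otimes> b \<otimes> word_val G u' = \<one> \<and> v \<in> L\<^sub>N \<and> v' \<in> L\<^sub>N \<and>
        word_val G v' = word_val G v \<otimes> x))" for b p q
  have "uniformly_coupled R"
    unfolding R_def[abs_def] using x
    by (intro uniformly_coupled_append uniformly_coupled_refl N.uniformly_coupled_right_mult
        H.alphabet_finite H.alphabet_closed) auto
  from uniformly_coupled_trans[OF this uniformly_coupled_same_product] show ?thesis
  proof (rule uniformly_coupled_mono)
    fix b p q assume "products_step x b p q"
    then obtain u v u' v' where w: "u \<in> L\<^sub>H" "v \<in> L\<^sub>N" "u' \<in> L\<^sub>H" "v' \<in> L\<^sub>N"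
      and pq: "b = \<one>" "p = u @ v" "q = u' @ v'"
      and eq: "word_val G u' \<otimes> word_val G v' = word_val G u \<otimes> word_val G v \<otimes> x"
      unfolding products_step_def by blast
    have "word_val G v \<otimes> x \<in> N"
      using w x by simp
    then obtain v1 where v1: "v1 \<in> L\<^sub>N" "word_val G v1 = word_val G v \<otimes> x"
      using N.language_represents by blast
    have "products_step \<one> \<one> (u @ v1) q"
      unfolding products_step_def using w pq v1 eq x
      by (intro conjI bexI[of _ u] bexI[of _ v1] bexI[of _ u'] bexI[of _ v']) (auto simp: m_assoc)
    moreover have "b = \<one> \<otimes> \<one>" using pq by simp
    moreover have "R \<one> p (u @ v1)"
      unfolding R_def using w pq v1
      by (intro exI[of _ u] exI[of _ v] exI[of _ u] exI[of _ v1]) simp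
    ultimately show "\<exists>b1 b2 r. b = b1 \<otimes> b2 \<and> R b1 p r \<and> products_step \<one> b2 r q" by blast
  qed
qed

text \<open>
  As before, but with words for \<open>h y\<close> and \<open>n\<^sup>y\<close>: the first pair ends in the difference \<open>y\<close>, from
  which the second pair is coupled.
\<close>

lemma uniformly_coupled_products_letter_H:
  assumes y: "y \<in> Y"
  shows "uniformly_coupled (products_step y)"
proof -
  have yH: "y \<in> H" using y H.alphabet_subset by auto
  then have yG: "y \<in> carrier G" by simp
  define R where "R b p q \<longleftrightarrow> (\<exists>u v u' v'. p = u @ v \<and> q = u' @ v' \<and>
      (b = \<one> \<and> u \<in> L\<^sub>H \<and> u' \<in> L\<^sub>H \<and> word_val G u' = word_val G u \<otimes> y) \<and>
      (inv (word_val G u) \<otimes> b \<otimes> word_val G u' = y \<and> v \<in> L\<^sub>N \<and> v' \<in> L\<^sub>N \<and>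
        word_val G v' = conj_by G (word_val G v) y))" for b p q
  have "uniformly_coupled R"
    unfolding R_def[abs_def] using yH by (intro uniformly_coupled_append H.uniformly_coupled_right_mult uniformly_coupled_conj y)
  from uniformly_coupled_trans[OF this uniformly_coupled_same_product] show ?thesis
  proof (rule uniformly_coupled_mono)
    fix b p q assume "products_step y b p q"
    then obtain u v u' v' where w: "u \<in> L\<^sub>H" "v \<in> L\<^sub>N" "u' \<in> L\<^sub>H" "v' \<in> L\<^sub>N"
      and pq: "b = \<one>" "p = u @ v" "q = u' @ v'"
      and eq: "word_val G u' \<otimes> word_val G v' = word_val G u \<otimes> word_val G v \<otimes> y"
      unfolding products_step_def by blast
    have "word_val G u \<otimes> y \<in> H"
      using w yH by simp
    then obtain u1 where u1: "u1 \<in> L\<^sub>H" "word_val G u1 = word_val G u \<otimes> y"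
      using H.language_represents by blast
    obtain v1 where v1: "v1 \<in> L\<^sub>N" "word_val G v1 = conj_by G (word_val G v) y"
      using N.language_represents[OF conj_by_mem[OF N.language_val_mem[OF w(2)] yG]] by blast
    have "word_val G u1 \<otimes> word_val G v1 = word_val G u \<otimes> word_val G v \<otimes> y"
      using w yG unfolding u1 v1 conj_by_def by (simp add: m_assoc mult_inv_cancel)
    then have "products_step \<one> \<one> (u1 @ v1) q"
      unfolding products_step_def using w pq u1 v1 eq yG
      by (intro conjI bexI[of _ u1] bexI[of _ v1] bexI[of _ u'] bexI[of _ v']) auto
    moreover have "b = \<one> \<otimes> \<one>" using pq by simp
    moreover have "R \<one> p (u1 @ v1)"
      unfolding R_def using w pq u1 v1 yG
      by (intro exI[of _ u] exI[of _ v] exI[of _ u1] exI[of _ v1]) (simp add: mult_inv_cancel)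
    ultimately show "\<exists>b1 b2 r. b = b1 \<otimes> b2 \<and> R b1 p r \<and> products_step \<one> b2 r q" by blast
  qed
qed

text \<open>
  Induction along a word for \<open>h n\<close> over \<open>X \<union> Y\<close>. Intermediate elements have representatives because
  \<open>H N\<close> is closed under multiplication.
\<close>

lemma uniformly_coupled_products:
  assumes "h \<in> H" "n \<in> N"
  shows "uniformly_coupled (products_step (h \<otimes> n))"
proof -
  have "uniformly_coupled (products_step (word_val G s))" if "s \<in> lists (X \<union> Y)" for s
    using that
  proof (induction s)
    case Nil
    show ?case using uniformly_coupled_same_product by simp
  next
    case (Cons x s)
    have x: "x \<in> carrier G" using Cons.hyps by auto
    have s: "s \<in> lists (carrier G)" using Cons.hyps N.alphabet_closed H.alphabet_closed lists_mono[of "X \<union> Y"] by auto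
    have "uniformly_coupled (products_step x)"
      using Cons.hyps uniformly_coupled_products_letter_N uniformly_coupled_products_letter_H by auto
    from uniformly_coupled_trans[OF this Cons.IH] show ?case
    proof (rule uniformly_coupled_mono)
      fix b p q assume "products_step (word_val G (x # s)) b p q"
      then obtain u v u' v' where w: "u \<in> L\<^sub>H" "v \<in> L\<^sub>N" "u' \<in> L\<^sub>H" "v' \<in> L\<^sub>N"
        and pq: "b = \<one>" "p = u @ v" "q = u' @ v'"
        and eq: "word_val G u' \<otimes> word_val G v' = word_val G u \<otimes> word_val G v \<otimes> word_val G (x # s)"
        unfolding products_step_def by blast
      have "\<exists>h\<in>H. \<exists>n\<in>N. x = h \<otimes> n"
      proof (cases "x \<in> X")
        case True
        then show ?thesis using x
          by (intro bexI[of _ \<one>] bexI[of _ x]) auto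
      next
        case False
        then show ?thesis using Cons.hyps x
          by (intro bexI[of _ x] bexI[of _ \<one>]) auto
      qed
      then obtain h n where hn: "h \<in> H" "n \<in> N" "word_val G u \<otimes> word_val G v \<otimes> x = h \<otimes> n"
        using product_mult[OF H.language_val_mem[OF w(1)] N.language_val_mem[OF w(2)]] by blast
      obtain u1 where u1: "u1 \<in> L\<^sub>H" "word_val G u1 = h" using H.language_represents hn by blast
      obtain v1 where v1: "v1 \<in> L\<^sub>N" "word_val G v1 = n" using N.language_represents hn by blast
      have "products_step x \<one> p (u1 @ v1)"
        unfolding products_step_def using w pq u1 v1 hn
        by (intro conjI bexI[of _ u] bexI[of _ v] bexI[of _ u1] bexI[of _ v1]) auto
      moreover have "products_step (word_val G s) \<one> (u1 @ v1) q"
        unfolding products_step_def using w pq u1 v1 hn(3)[symmetric] eq x s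
        by (intro conjI bexI[of _ u1] bexI[of _ v1] bexI[of _ u'] bexI[of _ v']) (auto simp: m_assoc)
      ultimately show "\<exists>b1 b2 r. b = b1 \<otimes> b2 \<and> products_step x b1 p r \<and> products_step (word_val G s) b2 r q"
        using pq by (intro exI[of _ \<one>] exI[of _ "u1 @ v1"]) simp
    qed
  qed
  note all = this
  obtain s where s: "s \<in> lists Y" "word_val G s = h" using H.words_generate assms by blast
  obtain t where t: "t \<in> lists X" "word_val G t = n" using N.words_generate assms by blast
  have "s @ t \<in> lists (X \<union> Y)"
    using s t lists_mono[of Y "X \<union> Y"] lists_mono[of X "X \<union> Y"] by auto
  from all[OF this] show ?thesis using s t by simp
qed

end

section \<open>The language for the whole group\<close>

context coupled_extension
begin

text \<open>
  A letter of \<open>T\<close> is appended even if \<open>T\<close> has only one element: it keeps the words non-empty, and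
  the empty word fellow travels only with itself.
\<close>

definition transversal_language :: "'a set \<Rightarrow> 'a list set" where
  "transversal_language T = {u @ v @ [t] |u v t. u \<in> L\<^sub>H \<and> v \<in> L\<^sub>N \<and> t \<in> T}"

text \<open>
  From \<open>g' t' = g t z\<close> with \<open>g, g' \<in> H N\<close> one gets \<open>g' = g c\<close> for \<open>c = t z t'\<^sup>-\<^sup>1\<close>. There are only
  finitely many such \<open>c\<close>, so the couplings of products that belong to them have a common finite set
  of differences.
\<close>

lemma uniformly_coupled_transversal_language:
  assumes T: "finite T" "T \<subseteq> carrier G" and Z: "finite Z" "Z \<subseteq> carrier G"
  shows "uniformly_coupled (\<lambda>b p q. b = \<one> \<and> p \<in> transversal_language T \<and> q \<in> transversal_language T \<and>
    (\<exists>z\<in>Z. word_val G q = word_val G p \<otimes> z))"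
proof -
  define I where "I = {(t, z, t') \<in> T \<times> Z \<times> T. \<exists>h\<in>H. \<exists>n\<in>N. t \<otimes> z \<otimes> inv t' = h \<otimes> n}"
  define R where "R i b p q \<longleftrightarrow> (case i of (t, z, t') \<Rightarrow> \<exists>p1 p2 q1 q2. p = p1 @ p2 \<and> q = q1 @ q2 \<and>
    products_step (t \<otimes> z \<otimes> inv t') b p1 q1 \<and>
    (inv (word_val G p1) \<otimes> b \<otimes> word_val G q1 = t \<otimes> z \<otimes> inv t' \<and> p2 = [t] \<and> q2 = [t']))" for i b p q
  have "finite I"
    by (rule finite_subset[of _ "T \<times> Z \<times> T"]) (use T Z in \<open>auto simp: I_def\<close>)
  moreover have "uniformly_coupled (R i)" if "i \<in> I" for i
  proof -
    obtain t z t' where i: "i = (t, z, t')" by (cases i) auto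
    then have tzt: "t \<in> carrier G" "z \<in> carrier G" "t' \<in> carrier G"
      and "\<exists>h\<in>H. \<exists>n\<in>N. t \<otimes> z \<otimes> inv t' = h \<otimes> n"
      using that T Z by (auto simp: I_def)
    then have "uniformly_coupled (products_step (t \<otimes> z \<otimes> inv t'))"
      using uniformly_coupled_products by auto
    moreover have "uniformly_coupled (\<lambda>b v w. b = t \<otimes> z \<otimes> inv t' \<and> v = [t] \<and> w = [t'])"
      using tzt by (intro uniformly_coupled_single) auto
    ultimately show ?thesis
      unfolding R_def[abs_def] i prod.case by (rule uniformly_coupled_append)
  qed
  ultimately have "uniformly_coupled (\<lambda>b p q. \<exists>i\<in>I. R i b p q)"
    by (rule uniformly_coupled_UN)
  then show ?thesis
  proof (rule uniformly_coupled_mono, elim conjE bexE)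
    fix b p q z
    assume b: "b = \<one>" and p: "p \<in> transversal_language T" and q: "q \<in> transversal_language T"
      and z: "z \<in> Z" and eq: "word_val G q = word_val G p \<otimes> z"
    obtain u v t where w: "u \<in> L\<^sub>H" "v \<in> L\<^sub>N" and t: "t \<in> T" and p_eq: "p = u @ v @ [t]"
      using p unfolding transversal_language_def by blast
    obtain u' v' t' where w': "u' \<in> L\<^sub>H" "v' \<in> L\<^sub>N" and t': "t' \<in> T" and q_eq: "q = u' @ v' @ [t']"
      using q unfolding transversal_language_def by blast
    have tzt: "t \<in> carrier G" "z \<in> carrier G" "t' \<in> carrier G" using t z t' T Z by auto
    let ?c = "t \<otimes> z \<otimes> inv t'"
    have "word_val G u' \<otimes> word_val G v' \<otimes> t' = word_val G u \<otimes> word_val G v \<otimes> t \<otimes> z"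
      using eq w w' tzt by (simp add: p_eq q_eq m_assoc)
    then have "word_val G u' \<otimes> word_val G v' \<otimes> t' \<otimes> inv t' = word_val G u \<otimes> word_val G v \<otimes> t \<otimes> z \<otimes> inv t'"
      by simp
    then have step: "word_val G u' \<otimes> word_val G v' = word_val G u \<otimes> word_val G v \<otimes> ?c"
      using w w' tzt by (simp add: m_assoc)
    then have c: "?c = inv (word_val G v) \<otimes> inv (word_val G u) \<otimes> (word_val G u' \<otimes> word_val G v')"
      using w w' tzt by (simp add: m_assoc mult_inv_cancel)
    also have "\<dots> = \<one> \<otimes> inv (word_val G v) \<otimes> ((inv (word_val G u) \<otimes> word_val G u') \<otimes> word_val G v')"
      using w w' by (simp add: m_assoc)
    finally have "\<exists>h\<in>H. \<exists>n\<in>N. ?c = h \<otimes> n"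
      using product_mult[of \<one> "inv (word_val G v)" "inv (word_val G u) \<otimes> word_val G u'" "word_val G v'"]
        w w' by auto
    then have "(t, z, t') \<in> I" using t t' z by (simp add: I_def)
    moreover have "products_step ?c b (u @ v) (u' @ v')"
      unfolding products_step_def using w w' step b by blast
    moreover have "inv (word_val G (u @ v)) \<otimes> b \<otimes> word_val G (u' @ v') = ?c"
      using w w' b c by (simp add: inv_mult_group m_assoc)
    ultimately show "\<exists>i\<in>I. R i b p q"
      unfolding R_def p_eq q_eq by (intro bexI[of _ "(t, z, t')"]) auto
  qed
qed

lemma async_combing_transversal_language:
  assumes T: "finite T" "T \<subseteq> carrier G"
    and cover: "\<And>g. g \<in> carrier G \<Longrightarrow> \<exists>h\<in>H. \<exists>n\<in>N. \<exists>t\<in>T. g = h \<otimes> n \<otimes> t"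
  shows "async_combing G (X \<union> Y \<union> T \<union> m_inv G ` T) (transversal_language T)"
proof -
  let ?Z = "X \<union> Y \<union> T \<union> m_inv G ` T"
  let ?L = "transversal_language T"
  have ZG: "?Z \<subseteq> carrier G" using T by auto
  interpret Z: symmetric_alphabet G ?Z
    using T ZG N.alphabet_inv H.alphabet_inv N.alphabet_finite H.alphabet_finite
    by unfold_locales auto
  have words: "?L \<subseteq> lists ?Z"
  proof
    fix p assume "p \<in> ?L"
    then obtain u v t where p: "u \<in> L\<^sub>H" "v \<in> L\<^sub>N" "t \<in> T" "p = u @ v @ [t]"
      unfolding transversal_language_def by blast
    have "u \<in> lists ?Z" "v \<in> lists ?Z"
      using p lists_mono[of Y ?Z] lists_mono[of X ?Z] H.language_subset N.language_subset by blast+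
    then show "p \<in> lists ?Z" using p by simp
  qed
  have represents: "\<exists>p\<in>?L. word_val G p = g" if g: "g \<in> carrier G" for g
  proof -
    obtain h n t where hnt: "h \<in> H" "n \<in> N" "t \<in> T" "g = h \<otimes> n \<otimes> t" using cover[OF g] by blast
    obtain u where u: "u \<in> L\<^sub>H" "word_val G u = h" using H.language_represents hnt by blast
    obtain v where v: "v \<in> L\<^sub>N" "word_val G v = n" using N.language_represents hnt by blast
    have "u @ v @ [t] \<in> ?L" using u v hnt unfolding transversal_language_def by blast
    moreover have "word_val G (u @ v @ [t]) = g"
      using u v hnt T by (auto simp: m_assoc)
    ultimately show ?thesis by blast
  qed
  have "generate G ?Z = carrier G"
  proof
    show "generate G ?Z \<subseteq> carrier G" by (rule generate_incl[OF ZG])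
    show "carrier G \<subseteq> generate G ?Z"
    proof
      fix g assume "g \<in> carrier G"
      then obtain p where "p \<in> ?L" "word_val G p = g" using represents by blast
      then show "g \<in> generate G ?Z" using words word_val_generate[of p ?Z] by blast
    qed
  qed
  then have gen: "generating_set G ?Z"
    unfolding generating_set_def
    using Z.alphabet_finite Z.alphabet_inv ZG by blast
  have lang: "language_for G ?Z ?L"
    unfolding language_for_def using words represents by blast
  have "uniformly_coupled (\<lambda>b p q. b = \<one> \<and> p \<in> ?L \<and> q \<in> ?L \<and>
      (\<exists>z\<in>?Z \<union> {\<one>}. word_val G q = word_val G p \<otimes> z))"
    using T Z.alphabet_finite ZG by (intro uniformly_coupled_transversal_language) auto
  from uniformly_coupledD[OF this] obtain B where B: "finite B" and
    "\<forall>b p q. (b = \<one> \<and> p \<in> ?L \<and> q \<in> ?L \<and> (\<exists>z\<in>?Z \<union> {\<one>}. word_val G q = word_val G p \<otimes> z)) \<longrightarrow>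
      b \<in> carrier G \<and> p \<in> lists (carrier G) \<and> q \<in> lists (carrier G) \<and> coupled B b p q"
    by (elim exE conjE)
  then have coupled: "coupled B \<one> p q"
    if "p \<in> ?L" "q \<in> ?L" "z \<in> ?Z \<union> {\<one>}" "word_val G q = word_val G p \<otimes> z" for p q z
    using that by blast
  obtain K where K: "\<And>p q. p \<in> lists ?Z \<Longrightarrow> q \<in> lists ?Z \<Longrightarrow> p \<noteq> [] \<Longrightarrow> q \<noteq> [] \<Longrightarrow>
      coupled B \<one> p q \<Longrightarrow> async_fellow_travel G ?Z K p q"
    using Z.async_fellow_travel_of_coupled[OF B] by blast
  have nonempty: "p \<noteq> []" if "p \<in> ?L" for p
    using that unfolding transversal_language_def by auto
  have "right_fellow_travel G ?Z K ?L"
    unfolding right_fellow_travel_def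
  proof (intro ballI impI)
    fix p q z
    assume "p \<in> ?L" "q \<in> ?L" "z \<in> ?Z \<union> {\<one>}" "word_val G q = word_val G p \<otimes> z"
    then show "async_fellow_travel G ?Z K p q"
      using words by (intro K coupled nonempty) auto
  qed
  then show ?thesis unfolding async_combing_def using gen lang by blast
qed

text \<open>
  A transversal with one element makes the last letter redundant, and \<open>H \<inter> N = {\<one>}\<close> makes the factors
  of a product in \<open>H N\<close> unique.
\<close>

lemma bijective_transversal_language:
  assumes comb: "async_combing G Z (transversal_language T)"
    and T: "T \<subseteq> carrier G" "\<And>s t. s \<in> T \<Longrightarrow> t \<in> T \<Longrightarrow> s = t"
    and "H \<inter> N = {\<one>}"
    and bij: "bijective_language (G\<lparr>carrier := N\<rparr>) X L\<^sub>N" "bijective_language (G\<lparr>carrier := H\<rparr>) Y L\<^sub>H"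
  shows "bijective_language G Z (transversal_language T)"
proof -
  have lang: "language_for G Z (transversal_language T)" using comb by (simp add: async_combing_def)
  have "p = q" if pq: "p \<in> transversal_language T" "q \<in> transversal_language T"
    and eq: "word_val G p = word_val G q" for p q
  proof -
    obtain u v t where p: "u \<in> L\<^sub>H" "v \<in> L\<^sub>N" "t \<in> T" "p = u @ v @ [t]"
      using pq unfolding transversal_language_def by blast
    obtain u' v' t' where q: "u' \<in> L\<^sub>H" "v' \<in> L\<^sub>N" "t' \<in> T" "q = u' @ v' @ [t']"
      using pq unfolding transversal_language_def by blast
    have t: "t' = t" "t \<in> carrier G" using T p q by auto
    have uv: "word_val G u \<otimes> word_val G v = word_val G u' \<otimes> word_val G v'"
      using eq p q t by (simp add: m_assoc[symmetric])
    have "inv (word_val G u') \<otimes> word_val G u = inv (word_val G u') \<otimes> (word_val G u \<otimes> word_val G v) \<otimes> inv (word_val G v)"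
      using p q by (simp add: m_assoc)
    also have "\<dots> = word_val G v' \<otimes> inv (word_val G v)"
      unfolding uv using p q by (simp add: mult_inv_cancel)
    finally have d: "inv (word_val G u') \<otimes> word_val G u = word_val G v' \<otimes> inv (word_val G v)" .
    have "inv (word_val G u') \<otimes> word_val G u \<in> H" using p q by simp
    moreover have "inv (word_val G u') \<otimes> word_val G u \<in> N" unfolding d using p q by simp
    ultimately have "inv (word_val G u') \<otimes> word_val G u = \<one>" using assms(4) by blast
    then have u: "word_val G u = word_val G u'" using p q by (simp add: inv_solve_left')
    then have v: "word_val G v = word_val G v'" using uv p q by simp
    have "u = u'" using bij(2) u p q unfolding bijective_language_def by fastforce
    moreover have "v = v'" using bij(1) v p q unfolding bijective_language_def by fastforce
    ultimately show "p = q" using p q t by simp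
  qed
  then show ?thesis using lang unfolding bijective_language_def language_for_def by metis
qed

end

section \<open>From asynchronous combings to coupled ones\<close>

lemma (in group) word_exists_of_generating_set:
  assumes "generating_set G X" "g \<in> carrier G"
  shows "\<exists>w\<in>lists X. word_val G w = g"
proof -
  interpret symmetric_alphabet G X
    using assms by unfold_locales (auto simp: generating_set_def)
  have "g \<in> generate G X" using assms by (simp add: generating_set_def)
  then show ?thesis
  proof (induction rule: generate.induct)
    case one
    show ?case by (rule bexI[of _ "[]"]) auto
  next
    case (incl x)
    then show ?case by (intro bexI[of _ "[x]"]) auto
  next
    case (inv x)
    then show ?case using alphabet_inv by (intro bexI[of _ "[inv x]"]) auto
  next
    case (eng g h)
    then obtain u v where "u \<in> lists X" "v \<in> lists X" "word_val G u = g" "word_val G v = h" by blast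
    then show ?case by (intro bexI[of _ "u @ v"]) auto
  qed
qed

lemma (in group) generating_set_subgroup:
  assumes S: "subgroup S G" and gen: "generating_set (G\<lparr>carrier := S\<rparr>) X"
  shows "X \<subseteq> S" "finite X" "\<And>x. x \<in> X \<Longrightarrow> inv x \<in> X" "\<And>g. g \<in> S \<Longrightarrow> \<exists>w\<in>lists X. word_val G w = g"
    "symmetric_alphabet G X"
proof -
  interpret S: group "G\<lparr>carrier := S\<rparr>" by (rule subgroup.subgroup_is_group[OF S is_group])
  show X: "X \<subseteq> S" "finite X" using gen by (auto simp: generating_set_def)
  show inv: "inv x \<in> X" if "x \<in> X" for x
    using gen that m_inv_consistent[OF S, of x] X(1) by (force simp: generating_set_def)
  show "\<exists>w\<in>lists X. word_val G w = g" if "g \<in> S" for g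
    using S.word_exists_of_generating_set[OF gen] that by simp
  show "symmetric_alphabet G X"
    using X inv subgroup.subset[OF S] by unfold_locales auto
qed

lemma (in group) coupled_combing_of_async_combing:
  assumes S: "subgroup S G" and comb: "async_combing (G\<lparr>carrier := S\<rparr>) X L"
  shows "coupled_combing G S X L"
proof -
  have gen: "generating_set (G\<lparr>carrier := S\<rparr>) X" and lang: "language_for (G\<lparr>carrier := S\<rparr>) X L"
    using comb by (auto simp: async_combing_def)
  note X = generating_set_subgroup[OF S gen]
  interpret X: symmetric_alphabet G X by (rule X(5))
  obtain K where K: "right_fellow_travel (G\<lparr>carrier := S\<rparr>) X K L"
    using comb by (auto simp: async_combing_def)
  show ?thesis
  proof (intro coupled_combing.intro coupled_combing_axioms.intro)
    show "Group.group G" by (rule is_group)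
    show "subgroup S G" by (rule S)
    show "X \<subseteq> S" "finite X" "\<And>x. x \<in> X \<Longrightarrow> inv x \<in> X" "\<And>g. g \<in> S \<Longrightarrow> \<exists>w\<in>lists X. word_val G w = g"
      using X by auto
    show "L \<subseteq> lists X" "\<And>g. g \<in> S \<Longrightarrow> \<exists>w\<in>L. word_val G w = g"
      using lang by (auto simp: language_for_def)
    show "uniformly_coupled (\<lambda>b v w. b = \<one> \<and> v \<in> L \<and> w \<in> L \<and>
        (\<exists>x\<in>X \<union> {\<one>}. word_val G w = word_val G v \<otimes> x))"
    proof (rule uniformly_coupled_mono[OF X.uniformly_coupled_async[of K]], elim conjE bexE)
      fix b v w x assume *: "b = \<one>" "v \<in> L" "w \<in> L" "x \<in> X \<union> {\<one>}" "word_val G w = word_val G v \<otimes> x"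
      then have "async_fellow_travel G X K v w"
        using K unfolding right_fellow_travel_def by auto
      then show "b = \<one> \<and> v \<in> lists X \<and> w \<in> lists X \<and> async_fellow_travel G X K v w"
        using * lang by (auto simp: language_for_def)
    qed
  qed
qed

lemma (in group) finite_transversal:
  assumes S: "finite (rcosets S)" "\<one> \<in> S" "S \<subseteq> carrier G"
  shows "\<exists>T. finite T \<and> T \<subseteq> carrier G \<and> (\<forall>g\<in>carrier G. \<exists>s\<in>S. \<exists>t\<in>T. g = s \<otimes> t) \<and>
    (S = carrier G \<longrightarrow> (\<forall>t\<in>T. \<forall>t'\<in>T. t = t'))"
proof -
  have "\<forall>C\<in>rcosets S. \<exists>a. a \<in> carrier G \<and> C = S #> a" by (auto simp: RCOSETS_def)
  from bchoice[OF this] obtain f where f: "\<forall>C\<in>rcosets S. f C \<in> carrier G \<and> C = S #> f C" ..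
  have "\<exists>s\<in>S. \<exists>t\<in>f ` (rcosets S). g = s \<otimes> t" if g: "g \<in> carrier G" for g
  proof -
    have C: "S #> g \<in> rcosets S" using g by (auto simp: RCOSETS_def)
    have "g \<in> S #> g" using g S(2) by (force simp: r_coset_def)
    also have "S #> g = S #> f (S #> g)" using f C by blast
    finally show ?thesis using C by (auto simp: r_coset_def)
  qed
  moreover have "t = t'" if "S = carrier G" "t \<in> f ` (rcosets S)" "t' \<in> f ` (rcosets S)" for t t'
  proof -
    have "C = carrier G" if C: "C \<in> rcosets S" for C
    proof -
      obtain a where "a \<in> carrier G" "C = carrier G #> a"
        using C \<open>S = carrier G\<close> unfolding RCOSETS_def by blast
      then show ?thesis using coset_join2[OF _ subgroup_self] by simp
    qed
    then show ?thesis using that by auto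
  qed
  ultimately show ?thesis
    using f S by (intro exI[of _ "f ` (rcosets S)"]) auto
qed

theorem proposition6p4:
  fixes G :: "('a, 'b) monoid_scheme"
    and N H X Y :: "'a set"
    and L\<^sub>N L\<^sub>H :: "'a list set"
    and F :: "'a list set set"
  assumes "nearly_split_extension G N H"
    and "language_family F"
    and "closed_under_concatenation F"
    and "async_F_combing F (G\<lparr>carrier := N\<rparr>) X L\<^sub>N"
    and "async_F_combing F (G\<lparr>carrier := H\<rparr>) Y L\<^sub>H"
    and "H \<inter> N \<noteq> {\<one>\<^bsub>G\<^esub>} \<Longrightarrow> async_bicombing (G\<lparr>carrier := N\<rparr>) X L\<^sub>N"
    and "\<exists>K. \<forall>n\<in>N. \<forall>y\<in>Y. \<forall>v\<in>L\<^sub>N. \<forall>v'\<in>L\<^sub>N. \<forall>w.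
           word_val G v = n \<longrightarrow> word_val G v' = conj_by G n y \<longrightarrow> is_image_under G L\<^sub>N v y w \<longrightarrow>
           async_fellow_travel (G\<lparr>carrier := N\<rparr>) X K v' w"
  shows "\<exists>Z L\<^sub>G. async_combing G Z L\<^sub>G \<and>
           (bijective_language (G\<lparr>carrier := N\<rparr>) X L\<^sub>N \<and> bijective_language (G\<lparr>carrier := H\<rparr>) Y L\<^sub>H \<and>
              split_extension G N H \<longrightarrow>
            bijective_language G Z L\<^sub>G)"
proof -
  have G: "group G" and normal: "N \<lhd> G" and H: "subgroup H G"
    and fin: "finite (rcosets\<^bsub>G\<^esub> (N <#>\<^bsub>G\<^esub> H))" "finite (N \<inter> H)"
    using assms(1) by (auto simp: nearly_split_extension_def)
  interpret group G by (rule G)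
  have N: "subgroup N G" using normal by (rule normal_imp_subgroup)
  have comb: "async_combing (G\<lparr>carrier := N\<rparr>) X L\<^sub>N" "async_combing (G\<lparr>carrier := H\<rparr>) Y L\<^sub>H"
    using assms(4,5) by (auto simp: async_F_combing_def)
  interpret N: coupled_combing G N X L\<^sub>N
    by (rule coupled_combing_of_async_combing[OF N comb(1)])
  interpret H: coupled_combing G H Y L\<^sub>H
    by (rule coupled_combing_of_async_combing[OF H comb(2)])
  interpret coupled_extension G N H X Y L\<^sub>N L\<^sub>H
  proof (intro coupled_extension.intro coupled_extension_axioms.intro)
    show "Group.group G" by (rule G)
    show "coupled_combing G N X L\<^sub>N" "coupled_combing G H Y L\<^sub>H"
      by unfold_locales
    show "N \<lhd> G" "finite (H \<inter> N)" using normal fin by (auto simp: Int_commute)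
    fix c assume c: "c \<in> H \<inter> N"
    show "uniformly_coupled (\<lambda>b v w. b = c \<and> v \<in> L\<^sub>N \<and> w \<in> L\<^sub>N \<and> word_val G v = c \<otimes>\<^bsub>G\<^esub> word_val G w)"
    proof (cases "H \<inter> N = {\<one>\<^bsub>G\<^esub>}")
      case True
      then have "c = \<one>\<^bsub>G\<^esub>" using c by blast
      then show ?thesis
        by (intro uniformly_coupled_mono[OF N.combing]) auto
    next
      case False
      then obtain K where K: "left_fellow_travel (G\<lparr>carrier := N\<rparr>) X K L\<^sub>N"
        using assms(6) by (auto simp: async_bicombing_def)
      have "uniformly_coupled (\<lambda>b v w. b = \<one>\<^bsub>G\<^esub> \<and>
        (\<exists>x\<in>X. \<exists>u\<in>L\<^sub>N. v = x # u \<and> w \<in> L\<^sub>N \<and> word_val G w = x \<otimes>\<^bsub>G\<^esub> word_val G u))"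
        by (rule uniformly_coupled_mono[OF N.uniformly_coupled_async[of K]])
          (use K in \<open>auto simp: left_fellow_travel_def\<close>)
      then show ?thesis using c by (intro N.uniformly_coupled_left_mult) auto
    qed
  next
    fix y assume y: "y \<in> Y"
    obtain K where K: "\<forall>n\<in>N. \<forall>y\<in>Y. \<forall>v\<in>L\<^sub>N. \<forall>v'\<in>L\<^sub>N. \<forall>w.
           word_val G v = n \<longrightarrow> word_val G v' = conj_by G n y \<longrightarrow> is_image_under G L\<^sub>N v y w \<longrightarrow>
           async_fellow_travel (G\<lparr>carrier := N\<rparr>) X K v' w" using assms(7) by blast
    show "uniformly_coupled (\<lambda>b v w. b = \<one>\<^bsub>G\<^esub> \<and> v \<in> L\<^sub>N \<and>
      (\<exists>u\<in>L\<^sub>N. word_val G v = conj_by G (word_val G u) y \<and> is_image_under G L\<^sub>N u y w))"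
    proof (rule uniformly_coupled_mono[OF N.uniformly_coupled_async[of K]], elim conjE bexE)
      fix b v w u
      assume *: "b = \<one>\<^bsub>G\<^esub>" "v \<in> L\<^sub>N" "u \<in> L\<^sub>N" "word_val G v = conj_by G (word_val G u) y"
        "is_image_under G L\<^sub>N u y w"
      then have "async_fellow_travel G X K v w" using K y N.language_val_mem by fastforce
      moreover have "w \<in> lists X"
      proof -
        obtain us where us: "list_all2 (\<lambda>x u. u \<in> L\<^sub>N \<and> word_val G u = conj_by G x y) u us" "w = concat us"
          using *(5) by (auto simp: is_image_under_def)
        have "concat us \<in> lists X"
          using us(1) by (induction rule: list_all2_induct) auto
        then show ?thesis using us by simp
      qed
      ultimately show "b = \<one>\<^bsub>G\<^esub> \<and> v \<in> lists X \<and> w \<in> lists X \<and> async_fellow_travel G X K v w"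
        using * by simp
    qed
  qed
  let ?S = "N <#>\<^bsub>G\<^esub> H"
  have "\<one>\<^bsub>G\<^esub> \<otimes>\<^bsub>G\<^esub> \<one>\<^bsub>G\<^esub> \<in> ?S"
    using N.mem_rules(1) H.mem_rules(1) unfolding set_mult_def by blast
  then have "\<one>\<^bsub>G\<^esub> \<in> ?S" by simp
  moreover have "?S \<subseteq> carrier G" by (auto simp: set_mult_def)
  ultimately obtain T where T: "finite T" "T \<subseteq> carrier G"
    and cover: "\<forall>g\<in>carrier G. \<exists>s\<in>?S. \<exists>t\<in>T. g = s \<otimes>\<^bsub>G\<^esub> t"
    and single: "?S = carrier G \<longrightarrow> (\<forall>t\<in>T. \<forall>t'\<in>T. t = t')"
    using finite_transversal[OF fin(1)] by meson
  have "\<exists>h\<in>H. \<exists>n\<in>N. \<exists>t\<in>T. g = h \<otimes>\<^bsub>G\<^esub> n \<otimes>\<^bsub>G\<^esub> t" if g: "g \<in> carrier G" for g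
  proof -
    obtain n h t where nht: "n \<in> N" "h \<in> H" "t \<in> T" "g = n \<otimes>\<^bsub>G\<^esub> h \<otimes>\<^bsub>G\<^esub> t"
      using bspec[OF cover g] unfolding set_mult_def by blast
    (* cosets of N H are given, but the words put the factor from H first *)
    then have "g = h \<otimes>\<^bsub>G\<^esub> conj_by G n h \<otimes>\<^bsub>G\<^esub> t"
      using T by (auto simp: conj_by_def m_assoc mult_inv_cancel subset_iff)
    then show ?thesis using nht conj_by_mem[of n h] by auto
  qed
  then have comb: "async_combing G (X \<union> Y \<union> T \<union> m_inv G ` T) (transversal_language T)"
    using T by (intro async_combing_transversal_language)
  show ?thesis
  proof (intro exI conjI impI)
    show "async_combing G (X \<union> Y \<union> T \<union> m_inv G ` T) (transversal_language T)" by (rule comb)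
    assume *: "bijective_language (G\<lparr>carrier := N\<rparr>) X L\<^sub>N \<and> bijective_language (G\<lparr>carrier := H\<rparr>) Y L\<^sub>H \<and>
      split_extension G N H"
    then have "?S = carrier G" "H \<inter> N = {\<one>\<^bsub>G\<^esub>}" by (auto simp: split_extension_def)
    then show "bijective_language G (X \<union> Y \<union> T \<union> m_inv G ` T) (transversal_language T)"
      using bijective_transversal_language[OF comb T(2)] single * by blast
  qed
qed

end
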